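(* Let $G$ be an acyclic network over a finite field $\mathbb F_q$ with a single connection $c=(S,T,\mathcal X(S,T))$, $S\ne T$, of rate $R(c)=|\mathcal X(S,T)|$. The following are equivalent: 1. The unicast connection $c$ is feasible. 2. $mincut(S,T)\ge R(c)$. 3. There exists an assignment of the coefficients $\alpha_{(i,e_j)}$, $\epsilon_{(e_i,(T,k))}$, $\beta_{(e_i,e_j)}$ such that the $R(c)\times R(c)$ system matrix $M$ is invertible in $\mathbb F_q$ (i.e. $\det(M)\ne0$).
   Context: Network. $G=(\mathcal V,\mathcal E)$ consists of a finite set $\mathcal V$ of nodes; each node $V$ has a finite set $I(V)$ of input ports and a finite set $O(V)$ of output ports (all these sets are pairwise disjoint). Each edge in $\mathcal E$ is an ordered pair $(e_1,e_2)$ with $e_1\in O(V_1)$ and $e_2\in I(V_2)$ for some $V_1,V_2\in\mathcal V$. $G$ is acyclic if the directed graph on $\mathcal V$ with an arc $V_1\to V_2$ whenever some edge goes from $O(V_1)$ to $I(V_2)$ has no directed cycle. Let $e_1,e_2,\dots$ enumerate all ports. Linear transmission. The source $S$ has independent processes (symbols in $\mathbb F_q$) $\mathcal X(S)=[X(S,1),\dots,X(S,\mu(S))]$ with $\mu(S)\le|O(S)|$; here $\mathcal X(S)=\mathcal X(S,T)$, so $\mu(S)=R(c)$. $Y(e)$ denotes the symbol at port $e$. For $e\in O(V)$: $Y(e)=\sum_{e'\in I(V)}\beta_{(e',e)}Y(e')$, plus $\sum_i\alpha_{(i,e)}X(S,i)$ if $V=S$. For an input port $e'$: $Y(e')=\sum_{(e,e')\in\mathcal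 E}Y(e)$. The destination forms $Z(T,k)=\sum_{e'\in I(T)}\epsilon_{(e',(T,k))}Y(e')$, $1\le k\le \nu(T)$, here with $\nu(T)=R(c)$. The coefficients $\alpha,\beta,\epsilon$ are freely chosen in $\mathbb F_q$. The connection is feasible if the coefficients can be chosen so that $\mathcal Z(T)=[Z(T,1),\dots,Z(T,\nu(T))]$ equals $\mathcal X(S,T)$ for all values of the source symbols. System matrix: $M$ is the matrix with $\mathcal Z(T)=\mathcal X(S)M$; explicitly $M=A(I-F)^{-1}B^T$, where $F$ is indexed by ports with $F_{i,j}=1$ if $(e_i,e_j)\in\mathcal E$, $F_{i,j}=\beta_{(e_i,e_j)}$ if $e_i\in I(V),e_j\in O(V)$ for some $V$, and $0$ otherwise; $A_{i,j}=\alpha_{(i,e_j)}$ if $e_j\in O(S)$, else $0$; and $B$ has entry $\epsilon_{(e_i,(T,k))}$ in row $k$, column $e_i$ if $e_i\in I(T)$, else $0$. Min-cut. $mincut(S,T)=\min_\Omega\operatorname{rank}(G_\Omega)$ over all $\Omega\subseteq\mathcal V$ with $S\in\Omega$, $T\notin\Omega$, where $G_\Omega$ is the $0$-$1$ matrix over $\mathbb F_q$ with rows the output ports of nodes in $\Omega$, columns the input ports of nodes in $\Omega^c$, and entry $1$ exactly when there is an edge from the row port to the column port. *)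

theory Defs
  imports
    "Jordan_Normal_Form.Matrix"
    "Jordan_Normal_Form.DL_Rank"
    "Jordan_Normal_Form.Gauss_Jordan_Elimination"
begin

record ('v, 'p) network =
  nodes :: "'v set"
  inports :: "'v \<Rightarrow> 'p set"
  outports :: "'v \<Rightarrow> 'p set"
  edges :: "('p \<times> 'p) set"

definition ports :: "('v, 'p) network \<Rightarrow> 'p set" where
  "ports G = (\<Union>v\<in>nodes G. inports G v \<union> outports G v)"

definition is_network :: "('v, 'p) network \<Rightarrow> bool" where
  "is_network G \<longleftrightarrow>
     finite (nodes G) \<and>
     (\<forall>v\<in>nodes G. finite (inports G v) \<and> finite (outports G v)) \<and>
     (\<forall>v\<in>nodes G. \<forall>w\<in>nodes G. inports G v \<inter> outports G w = {}) \<and>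
     (\<forall>v\<in>nodes G. \<forall>w\<in>nodes G. v \<noteq> w \<longrightarrow>
        inports G v \<inter> inports G w = {} \<and> outports G v \<inter> outports G w = {}) \<and>
     edges G \<subseteq> (\<Union>v\<in>nodes G. outports G v) \<times> (\<Union>v\<in>nodes G. inports G v)"

definition node_arcs :: "('v, 'p) network \<Rightarrow> ('v \<times> 'v) set" where
  "node_arcs G = {(v, w). v \<in> nodes G \<and> w \<in> nodes G \<and>
     (\<exists>(e1, e2)\<in>edges G. e1 \<in> outports G v \<and> e2 \<in> inports G w)}"

definition acyclic_network :: "('v, 'p) network \<Rightarrow> bool" where
  "acyclic_network G \<longleftrightarrow> acyclic (node_arcs G)"

(* The R source processes and the R decoded symbols are numbered 0, ..., R - 1. *)

definition transmission ::
  "('v, 'p) network \<Rightarrow> 'v \<Rightarrow> nat \<Rightarrow> (nat \<Rightarrow> 'p \<Rightarrow> 'f) \<Rightarrow> ('p \<Rightarrow> 'p \<Rightarrow> 'f) \<Rightarrow>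
   (nat \<Rightarrow> 'f) \<Rightarrow> ('p \<Rightarrow> 'f::field) \<Rightarrow> bool" where
  "transmission G S R \<alpha> \<beta> X Y \<longleftrightarrow>
     (\<forall>v\<in>nodes G. \<forall>e\<in>outports G v.
        Y e = (\<Sum>e'\<in>inports G v. \<beta> e' e * Y e') + (if v = S then \<Sum>i<R. \<alpha> i e * X i else 0)) \<and>
     (\<forall>v\<in>nodes G. \<forall>e'\<in>inports G v. Y e' = (\<Sum>e | (e, e') \<in> edges G. Y e))"

definition decoded ::
  "('v, 'p) network \<Rightarrow> 'v \<Rightarrow> ('p \<Rightarrow> nat \<Rightarrow> 'f) \<Rightarrow> ('p \<Rightarrow> 'f::field) \<Rightarrow> nat \<Rightarrow> 'f" where
  "decoded G T \<epsilon> Y k = (\<Sum>e'\<in>inports G T. \<epsilon> e' k * Y e')"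

(* In an acyclic network the port symbols Y are determined by X on all ports. The existence of
   a solution is required as well, so that the universal quantifier over Y is never vacuous. *)
definition feasible :: "'f::field itself \<Rightarrow> ('v, 'p) network \<Rightarrow> 'v \<Rightarrow> 'v \<Rightarrow> nat \<Rightarrow> bool" where
  "feasible _ G S T R \<longleftrightarrow>
     (\<exists>(\<alpha> :: nat \<Rightarrow> 'p \<Rightarrow> 'f) \<beta> \<epsilon>. \<forall>X.
        (\<exists>Y. transmission G S R \<alpha> \<beta> X Y) \<and>
        (\<forall>Y. transmission G S R \<alpha> \<beta> X Y \<longrightarrow> (\<forall>k<R. decoded G T \<epsilon> Y k = X k)))"

(* The list es enumerates the ports and thereby fixes the matrix indices. *)

definition F_matrix ::
  "('v, 'p) network \<Rightarrow> 'p list \<Rightarrow> ('p \<Rightarrow> 'p \<Rightarrow> 'f) \<Rightarrow> 'f::field mat" where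
  "F_matrix G es \<beta> = mat (length es) (length es) (\<lambda>(i, j).
     if (es ! i, es ! j) \<in> edges G then 1
     else if \<exists>v\<in>nodes G. es ! i \<in> inports G v \<and> es ! j \<in> outports G v then \<beta> (es ! i) (es ! j)
     else 0)"

definition A_matrix ::
  "('v, 'p) network \<Rightarrow> 'p list \<Rightarrow> 'v \<Rightarrow> nat \<Rightarrow> (nat \<Rightarrow> 'p \<Rightarrow> 'f) \<Rightarrow> 'f::field mat" where
  "A_matrix G es S R \<alpha> = mat R (length es) (\<lambda>(i, j).
     if es ! j \<in> outports G S then \<alpha> i (es ! j) else 0)"

definition B_matrix ::
  "('v, 'p) network \<Rightarrow> 'p list \<Rightarrow> 'v \<Rightarrow> nat \<Rightarrow> ('p \<Rightarrow> nat \<Rightarrow> 'f) \<Rightarrow> 'f::field mat" where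
  "B_matrix G es T R \<epsilon> = mat R (length es) (\<lambda>(k, i).
     if es ! i \<in> inports G T then \<epsilon> (es ! i) k else 0)"

(* mat_inverse returns None on a singular matrix; this does not occur for acyclic networks,
   where F is nilpotent. *)
definition system_matrix ::
  "('v, 'p) network \<Rightarrow> 'p list \<Rightarrow> 'v \<Rightarrow> 'v \<Rightarrow> nat \<Rightarrow>
   (nat \<Rightarrow> 'p \<Rightarrow> 'f) \<Rightarrow> ('p \<Rightarrow> 'p \<Rightarrow> 'f) \<Rightarrow> ('p \<Rightarrow> nat \<Rightarrow> 'f) \<Rightarrow> 'f::field mat" where
  "system_matrix G es S T R \<alpha> \<beta> \<epsilon> =
     A_matrix G es S R \<alpha> * the (mat_inverse (1\<^sub>m (length es) - F_matrix G es \<beta>)) *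
     transpose_mat (B_matrix G es T R \<epsilon>)"

definition cut_matrix :: "('v, 'p) network \<Rightarrow> 'p list \<Rightarrow> 'v set \<Rightarrow> 'f::field mat" where
  "cut_matrix G es \<Omega> =
     (let rs = filter (\<lambda>e. e \<in> (\<Union>v\<in>\<Omega>. outports G v)) es;
          cs = filter (\<lambda>e. e \<in> (\<Union>v\<in>nodes G - \<Omega>. inports G v)) es
      in mat (length rs) (length cs) (\<lambda>(i, j). if (rs ! i, cs ! j) \<in> edges G then 1 else 0))"

(* The first argument of vec_space.rank is the number of rows. *)
definition mincut ::
  "'f::field itself \<Rightarrow> ('v, 'p) network \<Rightarrow> 'p list \<Rightarrow> 'v \<Rightarrow> 'v \<Rightarrow> nat" where
  "mincut _ G es S T =
     Min ((\<lambda>\<Omega>. let C = (cut_matrix G es \<Omega> :: 'f mat) in vec_space.rank (dim_row C) C) `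
          {\<Omega>. \<Omega> \<subseteq> nodes G \<and> S \<in> \<Omega> \<and> T \<notin> \<Omega>})"

end

theory Submission
  imports Defs "Jordan_Normal_Form.Char_Poly"
    "HOL-Computational_Algebra.Polynomial_Factorial"
begin

text \<open>
  A code fails exactly if some nonzero source vector produces the zero output. If a cut has rank less
  than \<open>R\<close>, some nonzero source vector sends nothing across the cut, and by acyclicity all ports behind the
  cut carry zero.

  Conversely, suppose that all cuts have rank at least \<open>R\<close>. Relay nodes are eliminated one at a time.
  For a single cut, the largest rank that a suitable code at the eliminated node can achieve is the
  minimum of the ranks of the two cuts that put the node on either side. Over an infinite field one
  code works for all cuts simultaneously, so the elimination can be carried out over
  \<open>F\<^sub>q(x)\<close>. Each coefficient occupies a single entry of the linear system that
  describes the transmission, and such an entry can be replaced by 0 or 1 without losing injectivity;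
  the resulting code is defined over \<open>F\<^sub>q\<close>.
\<close>

subsection \<open>Rank and elimination of a node\<close>

text \<open>Elimination turns the 0-1 edge matrix into an arbitrary matrix, so the induction is
  stated for any \<open>E\<close> and remembers only the ranks of its cuts and the acyclicity of its
  support. One local code has to serve all cuts of the smaller network at once. A code that is good
  for the cuts treated so far and a code that is good for one more cut are joined by a line; each
  cut yields a determinant that is a nonzero polynomial in the parameter, and an infinite field has
  a point that avoids the finitely many roots. This is why \<open>F_q(x)\<close> enters.

  Substituting a value for \<open>x\<close> afterwards could fail, since a nonzero polynomial may
  vanish on all of \<open>F_q\<close>. Descent therefore works on a larger system than
  \<open>M\<close>: source symbols and port symbols are both unknowns, and no port has been solved
  for. Its determinant is affine in each coefficient separately, and an affine function that
  vanishes at 0 and at 1 vanishes everywhere, so a nonsingular choice survives a suitable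
  replacement of each coefficient by 0 or 1.\<close>

definition pairing :: "'a set \<Rightarrow> 'b set \<Rightarrow> ('a \<Rightarrow> 'b \<Rightarrow> 'k::field) \<Rightarrow> ('a \<Rightarrow> 'k) \<Rightarrow> ('b \<Rightarrow> 'k) \<Rightarrow> 'k" where
  "pairing A B H u w = (\<Sum>a\<in>A. \<Sum>b\<in>B. u a * H a b * w b)"

lemma pairing_left_linear:
  "pairing A B H (\<lambda>a. u a - v a) w = pairing A B H u w - pairing A B H v w"
  "pairing A B H (\<lambda>a. c * u a) w = c * pairing A B H u w"
  "pairing A B H (\<lambda>a. \<Sum>i\<in>N. f i * U i a) w = (\<Sum>i\<in>N. f i * pairing A B H (U i) w)"
proof -
  show "pairing A B H (\<lambda>a. u a - v a) w = pairing A B H u w - pairing A B H v w"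
    by (simp add: pairing_def left_diff_distrib sum_subtractf)
  show "pairing A B H (\<lambda>a. c * u a) w = c * pairing A B H u w"
    by (simp add: pairing_def sum_distrib_left mult.assoc)
  have "pairing A B H (\<lambda>a. \<Sum>i\<in>N. f i * U i a) w
      = (\<Sum>a\<in>A. \<Sum>b\<in>B. \<Sum>i\<in>N. f i * (U i a * H a b * w b))"
    by (simp add: pairing_def sum_distrib_right mult.assoc)
  also have "\<dots> = (\<Sum>i\<in>N. \<Sum>a\<in>A. \<Sum>b\<in>B. f i * (U i a * H a b * w b))"
    by (simp only: sum.swap[of _ N])
  finally show "pairing A B H (\<lambda>a. \<Sum>i\<in>N. f i * U i a) w = (\<Sum>i\<in>N. f i * pairing A B H (U i) w)"
    by (simp add: pairing_def sum_distrib_left)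
qed

lemma pairing_transpose: "pairing A B H u w = pairing B A (\<lambda>b a. H a b) w u"
  unfolding pairing_def by (subst sum.swap) (simp add: mult.commute mult.left_commute)

lemma pairing_right_linear:
  "pairing A B H u (\<lambda>b. w b - v b) = pairing A B H u w - pairing A B H u v"
  "pairing A B H u (\<lambda>b. c * w b) = c * pairing A B H u w"
  "pairing A B H u (\<lambda>b. \<Sum>i\<in>N. f i * W i b) = (\<Sum>i\<in>N. f i * pairing A B H u (W i))"
  by (simp_all add: pairing_transpose[of A B H] pairing_left_linear)

lemma pairing_matrix_linear:
  "pairing A B (\<lambda>a b. H a b + G a b) u w = pairing A B H u w + pairing A B G u w"
  "pairing A B (\<lambda>a b. c * H a b) u w = c * pairing A B H u w"
  by (simp_all add: pairing_def algebra_simps sum.distrib sum_distrib_left)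

text \<open>A certificate for rank at least \<open>r\<close>. In contrast to a nonzero minor it
  singles out no rows or columns, and it can be extended by one pair of vectors at a time.\<close>

definition dual_system ::
  "'a set \<Rightarrow> 'b set \<Rightarrow> ('a \<Rightarrow> 'b \<Rightarrow> 'k::field) \<Rightarrow> nat \<Rightarrow> (nat \<Rightarrow> 'a \<Rightarrow> 'k) \<Rightarrow> (nat \<Rightarrow> 'b \<Rightarrow> 'k) \<Rightarrow> bool" where
  "dual_system A B H r U W \<longleftrightarrow> (\<forall>i<r. \<forall>j<r. pairing A B H (U i) (W j) = (if i = j then 1 else 0))"

text \<open>The rank of \<open>H\<close> is bounded below by a witness, so that it visibly survives a field extension.\<close>

definition rank_ge :: "'a set \<Rightarrow> 'b set \<Rightarrow> ('a \<Rightarrow> 'b \<Rightarrow> 'k::field) \<Rightarrow> nat \<Rightarrow> bool" where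
  "rank_ge A B H r \<longleftrightarrow> (\<exists>U W. dual_system A B H r U W)"

lemma rank_ge_0: "rank_ge A B H 0"
  by (simp add: rank_ge_def dual_system_def)

lemma rank_ge_mono:
  assumes "rank_ge A B H r" "r' \<le> r"
  shows "rank_ge A B H r'"
proof -
  obtain U W where "dual_system A B H r U W" using assms(1) rank_ge_def by blast
  then have "dual_system A B H r' U W" using assms(2) by (simp add: dual_system_def)
  then show ?thesis using rank_ge_def by blast
qed

text \<open>Padding the \<open>r\<close> equations with zero rows gives a square matrix with a zero
  row, hence with determinant 0 and a nontrivial kernel.\<close>

lemma homogeneous_system_nontrivial:
  fixes g :: "nat \<Rightarrow> nat \<Rightarrow> 'k::field"
  assumes "r < R"
  obtains c where "\<exists>j<R. c j \<noteq> 0" "\<And>k. k < r \<Longrightarrow> (\<Sum>j<R. g k j * c j) = 0"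
proof -
  define M where "M = mat R R (\<lambda>(k, j). if k < r then g k j else 0)"
  have M: "M \<in> carrier_mat R R" by (simp add: M_def)
  have "mat\<^sub>r R R (\<lambda>i. if i = r then 0\<^sub>v R else row M i) = M"
    using assms by (intro eq_matI) (auto simp: M_def)
  then have "det M = 0" using det_row_0[OF assms, of "row M"] M by auto
  then obtain v where v: "v \<in> carrier_vec R" "v \<noteq> 0\<^sub>v R" "M *\<^sub>v v = 0\<^sub>v R"
    using det_0_iff_vec_prod_zero_field[OF M] by auto
  have "\<exists>j<R. v $ j \<noteq> 0" using v(1,2) by (metis carrier_vecD eq_vecI index_zero_vec)
  moreover have "(\<Sum>j<R. g k j * v $ j) = 0" if "k < r" for k
  proof -
    have "(M *\<^sub>v v) $ k = (\<Sum>j<R. g k j * v $ j)"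
      using that assms v(1) by (auto simp: M_def scalar_prod_def atLeast0LessThan intro!: sum.cong)
    then show ?thesis using v(3) that assms by simp
  qed
  ultimately show thesis using that by blast
qed

text \<open>If \<open>r < R\<close>, some nontrivial weights \<open>c\<close> annihilate the
  \<open>r\<close> rows of numbers \<open>g k (W j)\<close>. Weighting the identity matrix of
  pairings with \<open>c\<close> returns \<open>c\<close>, while the factorization returns
  0.\<close>

lemma dual_system_factor_bound:
  assumes D: "dual_system A B H R U W"
    and fac: "\<And>u w. pairing A B H u w = (\<Sum>k<r. f k u * g k w)"
  shows "R \<le> r"
proof (rule ccontr)
  assume "\<not> R \<le> r"
  then obtain c where c: "\<exists>j<R. c j \<noteq> 0" "\<And>k. k < r \<Longrightarrow> (\<Sum>j<R. g k (W j) * c j) = 0"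
    using homogeneous_system_nontrivial[of r R "\<lambda>k j. g k (W j)"] by auto
  have "c i = 0" if "i < R" for i
  proof -
    have "c i = (\<Sum>j<R. pairing A B H (U i) (W j) * c j)"
      using D that by (simp add: dual_system_def if_distrib[of "\<lambda>x. x * _"] cong: if_cong)
    also have "\<dots> = (\<Sum>j<R. \<Sum>k<r. f k (U i) * (g k (W j) * c j))"
      by (simp add: fac sum_distrib_right mult.assoc)
    also have "\<dots> = (\<Sum>k<r. f k (U i) * (\<Sum>j<R. g k (W j) * c j))"
      by (subst sum.swap) (simp add: sum_distrib_left)
    finally show ?thesis using c(2) by simp
  qed
  then show False using c(1) by blast
qed

lemma dual_system_augment:
  assumes D: "dual_system A B H r U W"
    and "\<And>j. j < r \<Longrightarrow> pairing A B H u (W j) = 0"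
    and "\<And>i. i < r \<Longrightarrow> pairing A B H (U i) w = 0"
    and nz: "pairing A B H u w \<noteq> 0"
  shows "rank_ge A B H (Suc r)"
proof -
  define c where "c = inverse (pairing A B H u w)"
  have "dual_system A B H (Suc r) (U(r := \<lambda>a. c * u a)) (W(r := w))"
    using assms unfolding dual_system_def c_def
    by (auto simp: less_Suc_eq pairing_left_linear)
  then show ?thesis unfolding rank_ge_def by blast
qed

text \<open>Oblique Gram-Schmidt: the component in the span of one family is measured by pairing
  with the other family.\<close>

lemma dual_system_proj:
  assumes "dual_system A B H r U W"
  shows "j < r \<Longrightarrow> pairing A B H (\<lambda>a. u a - (\<Sum>i<r. pairing A B H u (W i) * U i a)) (W j) = 0"
    and "i < r \<Longrightarrow> pairing A B H (U i) (\<lambda>b. w b - (\<Sum>j<r. pairing A B H (U j) w * W j b)) = 0"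
  using assms unfolding dual_system_def
  by (simp_all add: pairing_left_linear pairing_right_linear if_distrib[of "\<lambda>x. _ * x"] cong: if_cong)

text \<open>The remainders of \<open>u\<close> and \<open>w\<close> after projection pair to 0,
  since otherwise they would extend the dual system. Expanding this pairing expresses
  \<open>H\<close> as a product through \<open>r\<close> dimensions.\<close>

lemma rank_factorization:
  assumes D: "dual_system A B H r U W" and max: "\<not> rank_ge A B H (Suc r)"
  shows "pairing A B H u w = (\<Sum>i<r. pairing A B H u (W i) * pairing A B H (U i) w)"
proof -
  let ?u = "\<lambda>a. u a - (\<Sum>i<r. pairing A B H u (W i) * U i a)"
  let ?w = "\<lambda>b. w b - (\<Sum>j<r. pairing A B H (U j) w * W j b)"
  have "pairing A B H ?u ?w = 0"
    using dual_system_augment[OF D dual_system_proj[OF D]] max by blast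
  moreover have "pairing A B H ?u ?w = pairing A B H ?u w"
    using dual_system_proj(1)[OF D, of _ u] by (subst pairing_right_linear(1)) (simp add: pairing_right_linear(3))
  ultimately show ?thesis by (simp add: pairing_left_linear)
qed

text \<open>The largest certified rank \<open>r\<close> lies below \<open>R\<close>, and its
  maximality gives the factorization.\<close>

lemma rank_le_factorization:
  assumes "\<not> rank_ge A B H R"
  shows "\<exists>r U W. r < R \<and> dual_system A B H r U W \<and>
    (\<forall>u w. pairing A B H u w = (\<Sum>i<r. pairing A B H u (W i) * pairing A B H (U i) w))"
proof -
  define r where "r = (GREATEST r. rank_ge A B H r)"
  have bd: "r' \<le> R" if "rank_ge A B H r'" for r'
    using that assms rank_ge_mono by (metis nat_le_linear)
  have r: "rank_ge A B H r" unfolding r_def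
    by (rule GreatestI_nat[of _ 0 R]) (use rank_ge_0 bd in auto)
  have "\<not> rank_ge A B H (Suc r)"
    using Greatest_le_nat[of "rank_ge A B H" "Suc r" R] bd unfolding r_def by auto
  moreover obtain U W where "dual_system A B H r U W" using r rank_ge_def by blast
  moreover have "r < R" using r bd assms by (metis order_le_less)
  ultimately show ?thesis using rank_factorization by blast
qed

text \<open>The transfer matrix left after removing a node with input ports \<open>I\<close>, output ports \<open>J\<close> and
  local code \<open>\<beta>\<close>.\<close>

definition elim :: "('p \<Rightarrow> 'p \<Rightarrow> 'k::field) \<Rightarrow> 'p set \<Rightarrow> 'p set \<Rightarrow> ('p \<Rightarrow> 'p \<Rightarrow> 'k) \<Rightarrow> 'p \<Rightarrow> 'p \<Rightarrow> 'k" where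
  "elim E I J \<beta> a b = E a b + (\<Sum>m\<in>I. \<Sum>n\<in>J. E a m * \<beta> m n * E n b)"

text \<open>The local code enters only as a bilinear form of its own, evaluated at what
  \<open>u\<close> delivers to the node and what \<open>w\<close> collects from it.\<close>

lemma pairing_elim:
  "pairing A B (elim E I J \<beta>) u w = pairing A B E u w +
     pairing I J \<beta> (\<lambda>m. \<Sum>a\<in>A. u a * E a m) (\<lambda>n. \<Sum>b\<in>B. E n b * w b)"
proof -
  have "(\<Sum>a\<in>A. \<Sum>b\<in>B. u a * (\<Sum>m\<in>I. \<Sum>n\<in>J. E a m * \<beta> m n * E n b) * w b)
    = (\<Sum>a\<in>A. \<Sum>b\<in>B. \<Sum>m\<in>I. \<Sum>n\<in>J. u a * E a m * \<beta> m n * (E n b * w b))"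
    by (simp add: sum_distrib_left sum_distrib_right mult.assoc)
  also have "\<dots> = (\<Sum>a\<in>A. \<Sum>m\<in>I. \<Sum>b\<in>B. \<Sum>n\<in>J. u a * E a m * \<beta> m n * (E n b * w b))"
    by (rule sum.cong[OF refl], rule sum.swap)
  also have "\<dots> = (\<Sum>m\<in>I. \<Sum>a\<in>A. \<Sum>n\<in>J. \<Sum>b\<in>B. u a * E a m * \<beta> m n * (E n b * w b))"
    by (subst sum.swap, rule sum.cong[OF refl], rule sum.cong[OF refl], rule sum.swap)
  also have "\<dots> = (\<Sum>m\<in>I. \<Sum>n\<in>J. \<Sum>a\<in>A. \<Sum>b\<in>B. u a * E a m * \<beta> m n * (E n b * w b))"
    by (rule sum.cong[OF refl], rule sum.swap)
  also have "\<dots> = pairing I J \<beta> (\<lambda>m. \<Sum>a\<in>A. u a * E a m) (\<lambda>n. \<Sum>b\<in>B. E n b * w b)"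
    unfolding pairing_def by (intro sum.cong refl) (subst sum_distrib_right, simp only: sum_product)
  finally show ?thesis by (simp add: pairing_def elim_def algebra_simps sum.distrib)
qed

lemma pairing_rank_one:
  "pairing I J (\<lambda>m n. p m * q n) x y = (\<Sum>m\<in>I. x m * p m) * (\<Sum>n\<in>J. q n * y n)"
  by (simp add: pairing_def sum_product mult.assoc)

lemma pairing_alt:
  "pairing A B H u w = (\<Sum>b\<in>B. (\<Sum>a\<in>A. u a * H a b) * w b)"
  "pairing A B H u w = (\<Sum>a\<in>A. u a * (\<Sum>b\<in>B. H a b * w b))"
proof -
  show "pairing A B H u w = (\<Sum>b\<in>B. (\<Sum>a\<in>A. u a * H a b) * w b)"
    by (subst pairing_def, subst sum.swap) (simp add: sum_distrib_right)
  show "pairing A B H u w = (\<Sum>a\<in>A. u a * (\<Sum>b\<in>B. H a b * w b))"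
    by (simp add: pairing_def sum_distrib_left mult.assoc)
qed

text \<open>A rank-one change of the local code changes the transfer form by a product of two linear
  functionals.\<close>

lemma pairing_elim_add:
  "pairing A B (elim E I J (\<lambda>m n. \<beta> m n + p m * q n)) u w =
   pairing A B (elim E I J \<beta>) u w + pairing A I E u p * pairing J B E q w"
  by (simp add: pairing_elim pairing_matrix_linear pairing_rank_one pairing_alt(1)[of A I] pairing_alt(2)[of J B])

text \<open>If the rank cannot be increased by changing \<open>\<beta>\<close>, then a rank-one change \<open>p q\<^sup>T\<close> shows that
  the columns \<open>E p\<close> lie in the column space or the rows \<open>q E\<close> in the row space of the present matrix.\<close>

lemma elim_perturb:
  assumes D: "dual_system A B (elim E I J \<beta>) r U W"
    and max: "\<And>\<gamma>. \<not> rank_ge A B (elim E I J \<gamma>) (Suc r)"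
  defines "H \<equiv> elim E I J \<beta>"
  shows "pairing A I E u p = (\<Sum>i<r. pairing A B H u (W i) * pairing A I E (U i) p) \<or>
         pairing J B E q w = (\<Sum>i<r. pairing J B E q (W i) * pairing A B H (U i) w)"
proof (rule ccontr)
  assume neg: "\<not> ?thesis"
  \<comment> \<open>The remainders \<open>u'\<close> and \<open>w'\<close> lie in the left and right
    kernels of \<open>H\<close>, because \<open>r\<close> is maximal. The negated alternatives say
    that the functionals given by \<open>p\<close> and \<open>q\<close> do not vanish on
    them.\<close>
  define u' where "u' = (\<lambda>a. u a - (\<Sum>i<r. pairing A B H u (W i) * U i a))"
  define w' where "w' = (\<lambda>b. w b - (\<Sum>j<r. pairing A B H (U j) w * W j b))"
  note fac = rank_factorization[OF D max, folded H_def]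
  define x where "x v = pairing A I E v p" for v
  define y where "y v = pairing J B E q v" for v
  have u'0: "pairing A B H u' v = 0" for v
    unfolding u'_def using fac[of u v] by (simp add: pairing_left_linear)
  have w'0: "pairing A B H v w' = 0" for v
    unfolding w'_def pairing_right_linear by (simp add: fac[of v w] mult.commute)
  have x0: "x u' \<noteq> 0" using neg by (simp add: x_def u'_def pairing_left_linear)
  have y0: "y w' \<noteq> 0" using neg by (simp add: y_def w'_def pairing_right_linear) (simp add: mult.commute)
  define K where "K = elim E I J (\<lambda>m n. \<beta> m n + p m * q n)"
  have K: "pairing A B K v z = pairing A B H v z + x v * y z" for v z
    unfolding K_def H_def x_def y_def by (rule pairing_elim_add)
  \<comment> \<open>Corrections along \<open>u'\<close> and \<open>w'\<close> leave all
    \<open>H\<close>-pairings unchanged and make the old vectors invisible to the perturbation. The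
    pair \<open>u'\<close>, \<open>w'\<close>, visible only to the perturbation, then extends the
    system.\<close>
  define U' where "U' i = (\<lambda>a. U i a - x (U i) / x u' * u' a)" for i
  define W' where "W' i = (\<lambda>b. W i b - y (W i) / y w' * w' b)" for i
  have xU: "x (U' i) = 0" for i
    using x0 unfolding x_def U'_def pairing_left_linear by simp
  have yW: "y (W' i) = 0" for i
    using y0 unfolding y_def W'_def pairing_right_linear by simp
  have HU: "pairing A B H (U' i) (W' j) = pairing A B H (U i) (W j)" for i j
    unfolding U'_def W'_def pairing_left_linear pairing_right_linear by (simp add: u'0 w'0)
  have "dual_system A B K r U' W'"
    using D by (simp add: dual_system_def K xU HU H_def[symmetric])
  moreover have "pairing A B K u' (W' j) = 0" "pairing A B K (U' j) w' = 0" for j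
    by (simp_all add: K u'0 w'0 xU yW)
  moreover have "pairing A B K u' w' \<noteq> 0" by (simp add: K u'0 x0 y0)
  ultimately have "rank_ge A B K (Suc r)" by (rule dual_system_augment)
  then show False using max unfolding K_def by blast
qed

lemma pairing_Un_right:
  "finite B \<Longrightarrow> finite C \<Longrightarrow> B \<inter> C = {} \<Longrightarrow> pairing A (B \<union> C) H u w = pairing A B H u w + pairing A C H u w"
  by (simp add: pairing_def sum.union_disjoint sum.distrib)

lemma pairing_Un_left:
  "finite A \<Longrightarrow> finite C \<Longrightarrow> A \<inter> C = {} \<Longrightarrow> pairing (A \<union> C) B H u w = pairing A B H u w + pairing C B H u w"
  by (simp add: pairing_def sum.union_disjoint)

text \<open>Otherwise the largest rank \<open>r\<close> reached by any local code is below
  \<open>R\<close>. At such a code one of the two cut matrices has its column or row space no larger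
  than that of \<open>H\<close>, so it factors through \<open>r\<close> dimensions, against its
  rank.\<close>

lemma elim_rank:
  assumes fin: "finite A" "finite B" "finite I" "finite J" and disj: "B \<inter> I = {}" "A \<inter> J = {}"
    and 1: "rank_ge A (B \<union> I) E R" and 2: "rank_ge (A \<union> J) B E R"
  shows "\<exists>\<beta>. rank_ge A B (elim E I J \<beta>) R"
proof (rule ccontr)
  assume neg: "\<nexists>\<beta>. rank_ge A B (elim E I J \<beta>) R"
  define P where "P r = (\<exists>\<beta>. rank_ge A B (elim E I J \<beta>) r)" for r
  have P0: "P 0" by (simp add: P_def rank_ge_0)
  have bd: "r < R" if "P r" for r
    using that neg rank_ge_mono by (metis P_def not_le_imp_less)
  then obtain r where r: "P r" "\<not> P (Suc r)"
    using P0 by (metis nat_induct not_less_iff_gr_or_eq)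
  have "r < R" using bd r by blast
  obtain \<beta> U W where D: "dual_system A B (elim E I J \<beta>) r U W"
    using r(1) unfolding P_def rank_ge_def by blast
  have max: "\<not> rank_ge A B (elim E I J \<gamma>) (Suc r)" for \<gamma> using r(2) P_def by blast
  define H where "H = elim E I J \<beta>"
  note fac = rank_factorization[OF D max, folded H_def]
  \<comment> \<open>\<open>s\<close> pulls a vector on \<open>B\<close> back through the node to its
    inputs; \<open>t\<close> pushes a vector on \<open>A\<close> forward to its outputs.\<close>
  define s where "s w = (\<lambda>m. \<Sum>n\<in>J. \<beta> m n * (\<Sum>b\<in>B. E n b * w b))" for w
  define t where "t u = (\<lambda>n. \<Sum>m\<in>I. (\<Sum>a\<in>A. u a * E a m) * \<beta> m n)" for u
  have Hs: "pairing A B H u w = pairing A B E u w + pairing A I E u (s w)" for u w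
    unfolding H_def s_def by (simp add: pairing_elim pairing_alt(1)[of A I] pairing_alt(2)[of I J])
  have Ht: "pairing A B H u w = pairing A B E u w + pairing J B E (t u) w" for u w
    unfolding H_def t_def by (simp add: pairing_elim pairing_alt(2)[of J B] pairing_alt(1)[of I J])
  \<comment> \<open>The two alternatives of \<open>elim_perturb\<close> share no variable among
    \<open>u\<close>, \<open>p\<close>, \<open>q\<close>, \<open>w\<close>, so one of them holds for
    all values.\<close>
  consider "\<And>u p. pairing A I E u p = (\<Sum>i<r. pairing A B H u (W i) * pairing A I E (U i) p)"
    | "\<And>q w. pairing J B E q w = (\<Sum>i<r. pairing J B E q (W i) * pairing A B H (U i) w)"
    using elim_perturb[OF D max, folded H_def] by blast
  then show False
  proof cases
    case 1
    \<comment> \<open>A column operation: on \<open>B\<close>, \<open>E\<close> is \<open>H\<close>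
      minus a combination of the columns at \<open>I\<close>. These columns and those of
      \<open>H\<close> all lie in the column space of \<open>H\<close>.\<close>
    have "pairing A (B \<union> I) E u w = (\<Sum>i<r. pairing A B H u (W i) *
        (pairing A B H (U i) w + pairing A I E (U i) (\<lambda>b. w b - s w b)))" for u w
    proof -
      have "pairing A (B \<union> I) E u w = pairing A B E u w + pairing A I E u w"
        using fin disj by (simp add: pairing_Un_right)
      also have "\<dots> = pairing A B H u w + pairing A I E u (\<lambda>b. w b - s w b)"
        by (simp add: Hs pairing_right_linear)
      also have "\<dots> = (\<Sum>i<r. pairing A B H u (W i) *
        (pairing A B H (U i) w + pairing A I E (U i) (\<lambda>b. w b - s w b)))"
        by (subst fac, subst 1) (simp add: distrib_left sum.distrib)
      finally show ?thesis .
    qed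
    note fac' = this
    obtain U' W' where "dual_system A (B \<union> I) E R U' W'"
      using \<open>rank_ge A (B \<union> I) E R\<close> rank_ge_def by blast
    from dual_system_factor_bound[OF this fac'] show False using \<open>r < R\<close> by simp
  next
    case 2
    have "pairing (A \<union> J) B E u w = (\<Sum>i<r.
        (pairing A B H u (W i) + pairing J B E (\<lambda>b. u b - t u b) (W i)) * pairing A B H (U i) w)" for u w
    proof -
      have "pairing (A \<union> J) B E u w = pairing A B E u w + pairing J B E u w"
        using fin disj by (simp add: pairing_Un_left)
      also have "\<dots> = pairing A B H u w + pairing J B E (\<lambda>b. u b - t u b) w"
        by (simp add: Ht pairing_left_linear)
      also have "\<dots> = (\<Sum>i<r.
        (pairing A B H u (W i) + pairing J B E (\<lambda>b. u b - t u b) (W i)) * pairing A B H (U i) w)"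
        by (subst fac, subst 2) (simp add: distrib_right sum.distrib)
      finally show ?thesis .
    qed
    note fac' = this
    obtain U' W' where "dual_system (A \<union> J) B E R U' W'"
      using \<open>rank_ge (A \<union> J) B E R\<close> rank_ge_def by blast
    from dual_system_factor_bound[OF this fac'] show False using \<open>r < R\<close> by simp
  qed
qed

subsection \<open>Codes over infinite fields\<close>

text \<open>Keep the witness found at \<open>t0\<close> and let \<open>t\<close> vary. The
  determinant of its matrix of pairings is a polynomial in \<open>t\<close> with value 1 at
  \<open>t0\<close>; wherever it is nonzero, the inverse matrix turns \<open>W\<close> into a family
  dual to \<open>U\<close>.\<close>

lemma finite_rank_drop_on_line:
  fixes H0 H1 :: "'a \<Rightarrow> 'b \<Rightarrow> 'k::field"
  assumes "rank_ge A B (\<lambda>a b. H0 a b + t0 * H1 a b) R"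
  shows "finite {t. \<not> rank_ge A B (\<lambda>a b. H0 a b + t * H1 a b) R}"
proof -
  let ?H = "\<lambda>t a b. H0 a b + t * H1 a b"
  obtain U W where D: "dual_system A B (?H t0) R U W" using assms rank_ge_def by blast
  define M where "M t = mat R R (\<lambda>(i, j). pairing A B (?H t) (U i) (W j))" for t
  define P where "P = mat R R (\<lambda>(i, j). [:pairing A B H0 (U i) (W j), pairing A B H1 (U i) (W j):])"
  have MC: "M t \<in> carrier_mat R R" for t by (simp add: M_def)
  have "map_mat (\<lambda>p. poly p t) P = M t" for t
    by (intro eq_matI) (auto simp: P_def M_def pairing_matrix_linear)
  then have dP: "poly (det P) t = det (M t)" for t
    using comm_ring_hom.hom_det[OF poly_hom.comm_ring_hom_axioms, of t P] by simp
  have "M t0 = 1\<^sub>m R" using D by (intro eq_matI) (auto simp: M_def dual_system_def)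
  then have "det P \<noteq> 0" using dP[of t0] by auto
  then have "finite {t. poly (det P) t = 0}" by (rule poly_roots_finite)
  moreover have "rank_ge A B (?H t) R" if "poly (det P) t \<noteq> 0" for t
  proof -
    have "det (M t) \<noteq> 0" using that dP by simp
    then obtain C where C: "C \<in> carrier_mat R R" "M t * C = 1\<^sub>m R"
      using det_non_zero_imp_unit[OF MC] unfolding Units_def by (auto simp: ring_mat_def)
    have "pairing A B (?H t) (U i) (\<lambda>b. \<Sum>k<R. C $$ (k, j) * W k b) = (if i = j then 1 else 0)"
      if "i < R" "j < R" for i j
    proof -
      have "(M t * C) $$ (i, j) = (\<Sum>k<R. pairing A B (?H t) (U i) (W k) * C $$ (k, j))"
        using that C(1) by (auto simp: M_def scalar_prod_def atLeast0LessThan intro!: sum.cong)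
      then show ?thesis unfolding pairing_right_linear using C(2) that by (simp add: mult.commute)
    qed
    then have "dual_system A B (?H t) R U (\<lambda>j b. \<Sum>k<R. C $$ (k, j) * W k b)"
      unfolding dual_system_def by blast
    then show ?thesis using rank_ge_def by blast
  qed
  ultimately have "{t. \<not> rank_ge A B (?H t) R} \<subseteq> {t. poly (det P) t = 0}" by blast
  then show ?thesis using \<open>finite {t. poly (det P) t = 0}\<close> finite_subset by blast
qed

section \<open>One local code for all cuts\<close>

lemma elim_line:
  "elim E I J (\<lambda>m n. \<beta> m n + t * (\<gamma> m n - \<beta> m n)) a b =
   elim E I J \<beta> a b + t * (elim E I J \<gamma> a b - elim E I J \<beta> a b)"
  by (simp add: elim_def algebra_simps sum.distrib sum_subtractf sum_distrib_left)

text \<open>On the line from a code \<open>\<beta>\<close> for the old cuts to a code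
  \<open>\<gamma>\<close> for the new one, each cut is good at \<open>t = 0\<close> or at
  \<open>t = 1\<close>, hence at all but finitely many \<open>t\<close>.\<close>

lemma simultaneous_elim:
  fixes E :: "'p \<Rightarrow> 'p \<Rightarrow> 'k::field"
  assumes inf: "infinite (UNIV :: 'k set)" and "finite X"
    and "\<And>x. x \<in> X \<Longrightarrow> \<exists>\<beta>. rank_ge (A x) (B x) (elim E I J \<beta>) R"
  shows "\<exists>\<beta>. \<forall>x\<in>X. rank_ge (A x) (B x) (elim E I J \<beta>) R"
  using assms(2,3)
proof (induction X rule: finite_induct)
  case empty
  show ?case by simp
next
  case (insert x X)
  obtain \<beta> where \<beta>: "\<forall>y\<in>X. rank_ge (A y) (B y) (elim E I J \<beta>) R" using insert by auto
  obtain \<gamma> where \<gamma>: "rank_ge (A x) (B x) (elim E I J \<gamma>) R" using insert by auto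
  define L where "L t = elim E I J (\<lambda>m n. \<beta> m n + t * (\<gamma> m n - \<beta> m n))" for t
  have L: "L t = (\<lambda>a b. elim E I J \<beta> a b + t * (elim E I J \<gamma> a b - elim E I J \<beta> a b))" for t
    unfolding L_def by (intro ext) (rule elim_line)
  have fin: "finite {t. \<not> rank_ge (A y) (B y) (L t) R}" if "rank_ge (A y) (B y) (L t0) R" for y t0
    using that unfolding L by (rule finite_rank_drop_on_line)
  have "finite (\<Union>y\<in>insert x X. {t. \<not> rank_ge (A y) (B y) (L t) R})"
  proof (intro finite_UN_I)
    fix y assume "y \<in> insert x X"
    then consider "y = x" | "y \<in> X" by blast
    then show "finite {t. \<not> rank_ge (A y) (B y) (L t) R}"
    proof cases
      case 1
      then show ?thesis using fin[of x 1] \<gamma> by (simp add: L_def)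
    next
      case 2
      then show ?thesis using fin[of y 0] \<beta> by (simp add: L_def)
    qed
  qed (use insert in simp)
  then obtain t where "t \<notin> (\<Union>y\<in>insert x X. {t. \<not> rank_ge (A y) (B y) (L t) R})"
    using ex_new_if_finite[OF inf] by blast
  then have "\<forall>y\<in>insert x X. rank_ge (A y) (B y) (L t) R" by blast
  then show ?case unfolding L_def by blast
qed

text \<open>Here \<open>N\<close> is the set of relay nodes; \<open>S\<close> ignores its input ports and \<open>T\<close> sends nothing.\<close>

definition flow ::
  "('v \<Rightarrow> 'p set) \<Rightarrow> ('v \<Rightarrow> 'p set) \<Rightarrow> 'v \<Rightarrow> 'v \<Rightarrow> 'v set \<Rightarrow> nat \<Rightarrow> ('p \<Rightarrow> 'p \<Rightarrow> 'k::field) \<Rightarrow>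
   (nat \<Rightarrow> 'p \<Rightarrow> 'k) \<Rightarrow> ('p \<Rightarrow> 'p \<Rightarrow> 'k) \<Rightarrow> (nat \<Rightarrow> 'k) \<Rightarrow> ('p \<Rightarrow> 'k) \<Rightarrow> bool" where
  "flow I J S T N R E \<alpha> \<beta> X Y \<longleftrightarrow>
     (\<forall>e\<in>J S. Y e = (\<Sum>i<R. \<alpha> i e * X i)) \<and>
     (\<forall>v\<in>N. \<forall>e\<in>J v. Y e = (\<Sum>m\<in>I v. \<beta> m e * Y m)) \<and>
     (\<forall>v\<in>insert T N. \<forall>b\<in>I v. Y b = (\<Sum>a\<in>(\<Union>w\<in>insert S N. J w). Y a * E a b))"

text \<open>Substitute the local code of \<open>V\<close> into the equations of the remaining input
  ports. By \<open>loop\<close> the inputs of \<open>V\<close> do not depend on its own outputs, so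
  one substitution removes all ports of \<open>V\<close>.\<close>

lemma flow_elim:
  fixes E :: "'p \<Rightarrow> 'p \<Rightarrow> 'k::field"
  assumes fin: "finite N" "\<And>v. finite (I v)" "\<And>v. finite (J v)"
    and disj: "\<And>v w. v \<noteq> w \<Longrightarrow> J v \<inter> J w = {}"
    and V: "V \<notin> insert S N" and loop: "\<And>a b. a \<in> J V \<Longrightarrow> b \<in> I V \<Longrightarrow> E a b = 0"
    and \<beta>: "\<And>v m n. v \<in> N \<Longrightarrow> n \<in> J v \<Longrightarrow> \<beta>' m n = \<beta> m n"
      "\<And>m n. n \<in> J V \<Longrightarrow> \<beta>' m n = \<gamma> m n"
    and flow: "flow I J S T (insert V N) R E \<alpha> \<beta>' X Y"
  shows "flow I J S T N R (elim E (I V) (J V) \<gamma>) \<alpha> \<beta> X Y"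
proof -
  define D where "D = (\<Union>w\<in>insert S N. J w)"
  have "J w \<inter> J V = {}" if "w \<in> insert S N" for w
    by (rule disj) (use that V in auto)
  then have D: "finite D" "D \<inter> J V = {}" using fin(1,3) by (auto simp: D_def)
  have un: "(\<Union>w\<in>insert S (insert V N). J w) = D \<union> J V" by (auto simp: D_def)
  have out: "Y n = (\<Sum>m\<in>I V. \<gamma> m n * Y m)" if "n \<in> J V" for n
  proof -
    have "Y n = (\<Sum>m\<in>I V. \<beta>' m n * Y m)" using flow that unfolding flow_def by blast
    then show ?thesis using \<beta>(2)[OF that] by simp
  qed
  have inp: "Y b = (\<Sum>a\<in>D. Y a * E a b) + (\<Sum>a\<in>J V. Y a * E a b)" if "b \<in> I v" "v \<in> insert T (insert V N)" for v b
  proof -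
    have "Y b = (\<Sum>a\<in>D \<union> J V. Y a * E a b)" using flow that unfolding flow_def un by blast
    then show ?thesis using D fin(3) by (simp add: sum.union_disjoint)
  qed
  have inV: "Y m = (\<Sum>a\<in>D. Y a * E a m)" if "m \<in> I V" for m
  proof -
    have "(\<Sum>a\<in>J V. Y a * E a m) = 0" by (rule sum.neutral) (simp add: loop that)
    then show ?thesis using inp[OF that] by simp
  qed
  have "Y b = (\<Sum>a\<in>D. Y a * elim E (I V) (J V) \<gamma> a b)" if "b \<in> I v" "v \<in> insert T N" for v b
  proof -
    have "(\<Sum>n\<in>J V. Y n * E n b) = (\<Sum>n\<in>J V. \<Sum>m\<in>I V. \<Sum>a\<in>D. Y a * (E a m * \<gamma> m n * E n b))"
      by (intro sum.cong refl)
        (simp add: out inV sum_distrib_left sum_distrib_right mult.commute mult.left_commute)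
    also have "\<dots> = (\<Sum>n\<in>J V. \<Sum>a\<in>D. \<Sum>m\<in>I V. Y a * (E a m * \<gamma> m n * E n b))"
      by (rule sum.cong[OF refl], rule sum.swap)
    also have "\<dots> = (\<Sum>a\<in>D. \<Sum>n\<in>J V. \<Sum>m\<in>I V. Y a * (E a m * \<gamma> m n * E n b))"
      by (rule sum.swap)
    also have "\<dots> = (\<Sum>a\<in>D. \<Sum>m\<in>I V. \<Sum>n\<in>J V. Y a * (E a m * \<gamma> m n * E n b))"
      by (rule sum.cong[OF refl], rule sum.swap)
    finally have "(\<Sum>n\<in>J V. Y n * E n b) = (\<Sum>a\<in>D. \<Sum>m\<in>I V. \<Sum>n\<in>J V. Y a * (E a m * \<gamma> m n * E n b))" .
    moreover have "Y b = (\<Sum>a\<in>D. Y a * E a b) + (\<Sum>a\<in>J V. Y a * E a b)" using that by (intro inp[of b v]) auto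
    ultimately show ?thesis by (simp add: elim_def distrib_left sum.distrib sum_distrib_left)
  qed
  moreover have "Y e = (\<Sum>m\<in>I v. \<beta> m e * Y m)" if "v \<in> N" "e \<in> J v" for v e
  proof -
    have "Y e = (\<Sum>m\<in>I v. \<beta>' m e * Y m)" using flow that unfolding flow_def by blast
    then show ?thesis using \<beta>(1)[OF that] by simp
  qed
  moreover have "\<forall>e\<in>J S. Y e = (\<Sum>i<R. \<alpha> i e * X i)" using flow unfolding flow_def by blast
  ultimately show ?thesis unfolding flow_def D_def[symmetric] by blast
qed

text \<open>Induction on the relay nodes. The order \<open>r\<close> stays fixed while
  \<open>E\<close> changes: an entry created by eliminating \<open>V\<close> comes from a path
  through \<open>V\<close> and is covered by transitivity, and irreflexivity excludes loops at the
  next node.\<close>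

lemma unicast_coding:
  fixes E :: "'p \<Rightarrow> 'p \<Rightarrow> 'k::field"
  assumes inf: "infinite (UNIV :: 'k set)"
    and fin: "finite N" "\<And>v. finite (I v)" "\<And>v. finite (J v)"
    and disj: "\<And>v w. v \<noteq> w \<Longrightarrow> I v \<inter> I w = {}" "\<And>v w. v \<noteq> w \<Longrightarrow> J v \<inter> J w = {}"
    and "S \<notin> N" "T \<notin> N"
    and r: "trans r" "irrefl r"
    and "\<And>v w a b. v \<in> N \<Longrightarrow> w \<in> N \<Longrightarrow> a \<in> J v \<Longrightarrow> b \<in> I w \<Longrightarrow> E a b \<noteq> 0 \<Longrightarrow> (v, w) \<in> r"
    and "\<And>\<Omega>. \<Omega> \<subseteq> N \<Longrightarrow> rank_ge (\<Union>v\<in>insert S \<Omega>. J v) (\<Union>v\<in>insert T (N - \<Omega>). I v) E R"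
  shows "\<exists>\<alpha> \<beta> \<epsilon>. \<forall>X Y. flow I J S T N R E \<alpha> \<beta> X Y \<longrightarrow> (\<forall>k<R. (\<Sum>b\<in>I T. \<epsilon> b k * Y b) = X k)"
  using fin(1) assms(7,8,11,12)
proof (induction N arbitrary: E rule: finite_induct)
  case empty
  have "rank_ge (J S) (I T) E R" using empty(4)[of "{}"] by simp
  \<comment> \<open>Without relay nodes the rank certificate of the single cut is itself the code:
    \<open>U\<close> encodes and \<open>W\<close> decodes.\<close>
  then obtain U W where D: "dual_system (J S) (I T) E R U W" unfolding rank_ge_def by blast
  have "(\<Sum>b\<in>I T. W k b * Y b) = X k" if f: "flow I J S T {} R E U undefined X Y" and k: "k < R" for X Y k
  proof -
    have "(\<Sum>b\<in>I T. W k b * Y b) = pairing (J S) (I T) E Y (W k)"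
      using f unfolding flow_def pairing_alt(1) by (intro sum.cong) (simp_all add: mult.commute)
    also have "\<dots> = pairing (J S) (I T) E (\<lambda>a. \<Sum>i<R. X i * U i a) (W k)"
      using f unfolding flow_def pairing_def by (intro sum.cong) (simp_all add: mult.commute)
    also have "\<dots> = (\<Sum>i<R. X i * (if i = k then 1 else 0))"
      unfolding pairing_left_linear using D k by (simp add: dual_system_def)
    also have "\<dots> = X k" using k by (simp add: if_distrib[of "\<lambda>x. _ * x"] cong: if_cong)
    finally show ?thesis .
  qed
  then have "\<forall>X Y. flow I J S T {} R E U undefined X Y \<longrightarrow> (\<forall>k<R. (\<Sum>b\<in>I T. W k b * Y b) = X k)" by blast
  then show ?case by (intro exI[of _ U] exI[of _ undefined] exI[of _ "\<lambda>b k. W k b"])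
next
  case (insert V N)
  let ?O = "\<lambda>\<Omega>. \<Union>v\<in>insert S \<Omega>. J v" and ?I = "\<lambda>\<Omega>. \<Union>v\<in>insert T (N - \<Omega>). I v"
  have "\<exists>\<beta>. rank_ge (?O \<Omega>) (?I \<Omega>) (elim E (I V) (J V) \<beta>) R" if "\<Omega> \<in> Pow N" for \<Omega>
  proof (rule elim_rank)
    have \<Omega>: "finite \<Omega>" "\<Omega> \<subseteq> N" "V \<notin> \<Omega>" using that insert(1,2) finite_subset by auto
    show "finite (?O \<Omega>)" "finite (?I \<Omega>)" "finite (I V)" "finite (J V)"
      using fin(2,3) \<Omega>(1) insert(1) by simp_all
    have "I v \<inter> I V = {}" if "v \<in> insert T (N - \<Omega>)" for v
      by (rule disj(1)) (use that insert(2,5) in auto)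
    then show "?I \<Omega> \<inter> I V = {}" by blast
    have "J v \<inter> J V = {}" if "v \<in> insert S \<Omega>" for v
      by (rule disj(2)) (use that insert(4) \<Omega> in auto)
    then show "?O \<Omega> \<inter> J V = {}" by blast
    \<comment> \<open>The cuts \<open>\<Omega>\<close> and \<open>insert V \<Omega>\<close> of the
      larger network put \<open>V\<close> on the sink side and on the source side; they supply the
      two rank hypotheses of \<open>elim_rank\<close>.\<close>
    have "?I \<Omega> \<union> I V = (\<Union>v\<in>insert T (insert V N - \<Omega>). I v)" using \<Omega> by auto
    then show "rank_ge (?O \<Omega>) (?I \<Omega> \<union> I V) E R" using insert(7)[of \<Omega>] \<Omega> by auto
    have "?O \<Omega> \<union> J V = ?O (insert V \<Omega>)" "?I \<Omega> = (\<Union>v\<in>insert T (insert V N - insert V \<Omega>). I v)"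
      using insert(2) by auto
    moreover have "insert V \<Omega> \<subseteq> insert V N" using \<Omega> by blast
    ultimately show "rank_ge (?O \<Omega> \<union> J V) (?I \<Omega>) E R" using insert(7) by metis
  qed
  then have "\<exists>\<gamma>. \<forall>\<Omega>\<in>Pow N. rank_ge (?O \<Omega>) (?I \<Omega>) (elim E (I V) (J V) \<gamma>) R"
    using insert(1) by (intro simultaneous_elim[OF inf]) simp_all
  then obtain \<gamma> where
    \<gamma>: "rank_ge (?O \<Omega>) (?I \<Omega>) (elim E (I V) (J V) \<gamma>) R" if "\<Omega> \<subseteq> N" for \<Omega>
    by (auto simp only: Ball_def Pow_iff)
  have acyc: "(v, w) \<in> r" if "v \<in> N" "w \<in> N" "a \<in> J v" "b \<in> I w" "elim E (I V) (J V) \<gamma> a b \<noteq> 0" for v w a b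
  proof (cases "E a b = 0")
    case True
    \<comment> \<open>An entry that is nonzero only after elimination forces a path from
      \<open>v\<close> through \<open>V\<close> to \<open>w\<close>.\<close>
    then have "(\<Sum>m\<in>I V. \<Sum>n\<in>J V. E a m * \<gamma> m n * E n b) \<noteq> 0" using that(5) by (simp add: elim_def)
    then obtain m where "m \<in> I V" "(\<Sum>n\<in>J V. E a m * \<gamma> m n * E n b) \<noteq> 0" by (meson sum.neutral)
    moreover from this obtain n where "n \<in> J V" "E a m * \<gamma> m n * E n b \<noteq> 0" by (meson sum.neutral)
    ultimately have "(v, V) \<in> r" "(V, w) \<in> r" using insert(6) that by auto
    then show ?thesis using r(1) by (meson transD)
  qed (use insert(6) that in auto)
  have "\<exists>\<alpha> \<beta> \<epsilon>. \<forall>X Y. flow I J S T N R (elim E (I V) (J V) \<gamma>) \<alpha> \<beta> X Y \<longrightarrow>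
      (\<forall>k<R. (\<Sum>b\<in>I T. \<epsilon> b k * Y b) = X k)"
    by (rule insert(3)) (use insert(4,5) in simp, use insert(4,5) in simp, fact acyc, fact \<gamma>)
  then obtain \<alpha> \<beta> \<epsilon> where
    sol: "\<And>X Y. flow I J S T N R (elim E (I V) (J V) \<gamma>) \<alpha> \<beta> X Y \<Longrightarrow> \<forall>k<R. (\<Sum>b\<in>I T. \<epsilon> b k * Y b) = X k"
    by blast
  \<comment> \<open>Output ports of different nodes are disjoint, so the output port alone decides
    which of the two codes applies.\<close>
  define \<beta>' where "\<beta>' m n = (if n \<in> J V then \<gamma> m n else \<beta> m n)" for m n
  have "flow I J S T N R (elim E (I V) (J V) \<gamma>) \<alpha> \<beta> X Y" if "flow I J S T (insert V N) R E \<alpha> \<beta>' X Y" for X Y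
  proof (rule flow_elim[OF insert(1) fin(2,3) disj(2) _ _ _ _ that])
    show "V \<notin> insert S N" using insert(2,4) by auto
    show "E a b = 0" if "a \<in> J V" "b \<in> I V" for a b
      using insert(6)[of V V a b] that r(2) by (auto simp: irrefl_def)
    show "\<beta>' m n = \<beta> m n" if "v \<in> N" "n \<in> J v" for v m n
      using that disj(2)[of v V] insert(2) by (auto simp: \<beta>'_def)
  qed (simp_all add: \<beta>'_def)
  then have sol': "\<forall>X Y. flow I J S T (insert V N) R E \<alpha> \<beta>' X Y \<longrightarrow> (\<forall>k<R. (\<Sum>b\<in>I T. \<epsilon> b k * Y b) = X k)"
    using sol by simp
  show ?case by (intro exI) (rule sol')
qed

text \<open>Coefficients found over an extension field can be replaced one at a time by 0 or 1: if an entry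
  \<open>t\<close> is free and both the values 0 and 1 admit nonzero kernel vectors, some combination of these two
  vectors is a nonzero kernel vector for the value \<open>t\<close>.\<close>

lemma injective_system_01:
  fixes L :: "'r \<Rightarrow> 'c \<Rightarrow> 'k::field"
  assumes "finite C" "finite P" "P \<subseteq> Q \<times> C"
    and inj: "\<forall>y. (\<forall>r\<in>Q. (\<Sum>c\<in>C. L r c * y c) = 0) \<longrightarrow> (\<forall>c\<in>C. y c = 0)"
  shows "\<exists>L'. (\<forall>r c. (r, c) \<notin> P \<longrightarrow> L' r c = L r c) \<and> (\<forall>r c. (r, c) \<in> P \<longrightarrow> L' r c \<in> {0, 1}) \<and>
    (\<forall>y. (\<forall>r\<in>Q. (\<Sum>c\<in>C. L' r c * y c) = 0) \<longrightarrow> (\<forall>c\<in>C. y c = 0))"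
  using assms(2,3)
proof (induction P rule: finite_induct)
  case empty
  show ?case using inj by (intro exI[of _ L]) simp
next
  case (insert p P)
  obtain r c where p: "p = (r, c)" by (cases p)
  have rc: "r \<in> Q" "c \<in> C" using insert(4) p by auto
  have "P \<subseteq> Q \<times> C" using insert(4) by simp
  from insert(3)[OF this] obtain L' where
    L'1: "\<forall>r c. (r, c) \<notin> P \<longrightarrow> L' r c = L r c" and L'2: "\<forall>r c. (r, c) \<in> P \<longrightarrow> L' r c \<in> {0, 1}"
    and L'3: "\<forall>y. (\<forall>r\<in>Q. (\<Sum>c\<in>C. L' r c * y c) = 0) \<longrightarrow> (\<forall>c\<in>C. y c = 0)"
    by (elim exE conjE)
  define M where "M s r' c' = (if (r', c') = (r, c) then s else L' r' c')" for s r' c'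
  let ?t = "L' r c"
  let ?ker = "\<lambda>s y. \<forall>q\<in>Q. (\<Sum>c\<in>C. M s q c * y c) = 0"
  \<comment> \<open>Replacing the entry at \<open>(r, c)\<close> affects row \<open>r\<close> only,
    so a kernel vector for the value \<open>s\<close> misses the kernel of \<open>L'\<close> by
    \<open>(?t - s) * y c\<close> in that row.\<close>
  have M: "(\<Sum>c'\<in>C. L' q c' * y c') = (\<Sum>c'\<in>C. M s q c' * y c') + (if q = r then (?t - s) * y c else 0)" for q s y
  proof -
    have "(\<Sum>c'\<in>C. L' q c' * y c') - (\<Sum>c'\<in>C. M s q c' * y c')
      = (\<Sum>c'\<in>C. if c' = c then (if q = r then (?t - s) * y c else 0) else 0)"
      unfolding sum_subtractf[symmetric] by (rule sum.cong) (auto simp: M_def algebra_simps)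
    then show ?thesis using rc(2) \<open>finite C\<close> by (simp add: algebra_simps)
  qed
  have "\<exists>s\<in>{0,1}. \<forall>y. ?ker s y \<longrightarrow> (\<forall>c\<in>C. y c = 0)"
  proof (rule ccontr)
    assume "\<not> ?thesis"
    then have neg: "\<not> (\<forall>y. ?ker s y \<longrightarrow> (\<forall>c\<in>C. y c = 0))" if "s \<in> {0, 1}" for s
      using that by blast
    obtain y0 where y0: "?ker 0 y0" "\<not> (\<forall>c\<in>C. y0 c = 0)" using neg[of 0] by blast
    obtain y1 where y1: "?ker 1 y1" "\<not> (\<forall>c\<in>C. y1 c = 0)" using neg[of 1] by blast
    have e0: "(\<Sum>c'\<in>C. L' q c' * y0 c') = (if q = r then ?t * y0 c else 0)" if "q \<in> Q" for q
      using M[of q y0 0] y0(1) that by simp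
    have e1: "(\<Sum>c'\<in>C. L' q c' * y1 c') = (if q = r then (?t - 1) * y1 c else 0)" if "q \<in> Q" for q
      using M[of q y1 1] y1(1) that by simp
    \<comment> \<open>A kernel vector that vanishes at \<open>c\<close> does not notice the changed
      entry and would lie in the kernel of \<open>L'\<close>.\<close>
    have n0: "y0 c \<noteq> 0"
    proof
      assume "y0 c = 0"
      then have "\<forall>q\<in>Q. (\<Sum>c'\<in>C. L' q c' * y0 c') = 0" using e0 by simp
      then show False using L'3 y0(2) by blast
    qed
    have n1: "y1 c \<noteq> 0"
    proof
      assume "y1 c = 0"
      then have "\<forall>q\<in>Q. (\<Sum>c'\<in>C. L' q c' * y1 c') = 0" using e1 by simp
      then show False using L'3 y1(2) by blast
    qed
    \<comment> \<open>The weights make the defects \<open>?t * y0 c\<close> and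
      \<open>(?t - 1) * y1 c\<close> in row \<open>r\<close> cancel, and they sum up to the nonzero
      value \<open>y0 c * y1 c\<close> at \<open>c\<close>.\<close>
    define z where "z c' = (1 - ?t) * y1 c * y0 c' + ?t * y0 c * y1 c'" for c'
    have zs: "(\<Sum>c'\<in>C. L' q c' * z c') = (1 - ?t) * y1 c * (\<Sum>c'\<in>C. L' q c' * y0 c')
        + ?t * y0 c * (\<Sum>c'\<in>C. L' q c' * y1 c')" for q
      by (simp add: z_def sum_distrib_left sum.distrib[symmetric] algebra_simps)
    have "(\<Sum>c'\<in>C. L' q c' * z c') = 0" if "q \<in> Q" for q
      unfolding zs e0[OF that] e1[OF that] by (simp add: algebra_simps)
    then have "z c = 0" using L'3 rc(2) by blast
    moreover have "z c = y0 c * y1 c" by (simp add: z_def algebra_simps)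
    ultimately show False using n0 n1 by simp
  qed
  then obtain s where s: "s \<in> {0, 1}" "\<forall>y. ?ker s y \<longrightarrow> (\<forall>c\<in>C. y c = 0)" by blast
  show ?case
  proof (intro exI[of _ "M s"] conjI)
    show "\<forall>r c. (r, c) \<notin> insert p P \<longrightarrow> M s r c = L r c"
    proof (intro allI impI)
      fix r' c' assume "(r', c') \<notin> insert p P"
      then have "M s r' c' = L' r' c'" "(r', c') \<notin> P" by (auto simp: M_def p)
      then show "M s r' c' = L r' c'" using L'1 by metis
    qed
    show "\<forall>r c. (r, c) \<in> insert p P \<longrightarrow> M s r c \<in> {0, 1}"
    proof (intro allI impI)
      fix r' c' assume "(r', c') \<in> insert p P"
      then consider "(r', c') = (r, c)" | "(r', c') \<noteq> (r, c)" "(r', c') \<in> P" using p by blast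
      then show "M s r' c' \<in> {0, 1}"
      proof cases
        case 1
        then show ?thesis using s(1) by (simp add: M_def)
      next
        case 2
        have "M s r' c' = L' r' c'" unfolding M_def using 2(1) by (rule if_not_P)
        then show ?thesis using 2(2) L'2 by metis
      qed
    qed
    show "\<forall>y. ?ker s y \<longrightarrow> (\<forall>c\<in>C. y c = 0)" by (rule s(2))
  qed
qed

subsection \<open>Rank of matrices\<close>

lemma rank_ge_reindex:
  assumes f: "bij_betw f A A'" and g: "bij_betw g B B'"
    and H: "\<And>a b. a \<in> A \<Longrightarrow> b \<in> B \<Longrightarrow> H a b = H' (f a) (g b)"
  shows "rank_ge A B H R \<longleftrightarrow> rank_ge A' B' H' R"
proof
  have eq: "pairing A B H (\<lambda>a. u (f a)) (\<lambda>b. w (g b)) = pairing A' B' H' u w" for u w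
    unfolding pairing_def sum.reindex_bij_betw[OF f, symmetric] sum.reindex_bij_betw[OF g, symmetric]
    by (intro sum.cong refl) (simp add: H)
  {
    assume "rank_ge A' B' H' R"
    then obtain U W where "dual_system A' B' H' R U W" using rank_ge_def by blast
    then have "dual_system A B H R (\<lambda>i a. U i (f a)) (\<lambda>i b. W i (g b))"
      by (simp add: dual_system_def eq)
    then show "rank_ge A B H R" using rank_ge_def by blast
  next
    assume "rank_ge A B H R"
    then obtain U W where D: "dual_system A B H R U W" using rank_ge_def by blast
    have "pairing A B H (\<lambda>a. u (inv_into A f (f a))) (\<lambda>b. w (inv_into B g (g b))) = pairing A B H u w" for u w
      using bij_betw_inv_into_left[OF f] bij_betw_inv_into_left[OF g]
      unfolding pairing_def by (intro sum.cong refl) simp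
    then have "pairing A' B' H' (\<lambda>a. u (inv_into A f a)) (\<lambda>b. w (inv_into B g b)) = pairing A B H u w" for u w
      using eq[of "\<lambda>a. u (inv_into A f a)" "\<lambda>b. w (inv_into B g b)"] by simp
    then have "dual_system A' B' H' R (\<lambda>i a. U i (inv_into A f a)) (\<lambda>i b. W i (inv_into B g b))"
      using D by (simp add: dual_system_def)
    then show "rank_ge A' B' H' R" using rank_ge_def by blast
  }
qed

text \<open>Each product of a column and a row has rank at most 1, and rank is subadditive.\<close>

lemma (in vec_space) rank_outer_sum_le:
  "rank (mat n nc (\<lambda>(i, j). \<Sum>k<r. f k i * g k j)) \<le> r"
proof (induction r)
  case 0
  have "mat n nc (\<lambda>(i, j). \<Sum>k<0. f k i * g k j) = 0\<^sub>m n nc" by (intro eq_matI) auto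
  then show ?case by (simp only: rank_0I)
next
  case (Suc r)
  let ?M = "\<lambda>r. mat n nc (\<lambda>(i, j). \<Sum>k<r. f k i * g k j)"
  let ?N = "mat n nc (\<lambda>(i, j). f r i * g r j)"
  have "?M (Suc r) = ?M r + ?N" by (intro eq_matI) auto
  moreover have "rank ?N \<le> 1" by (rule rank_le_1_product_entries) auto
  moreover have "rank (?M r + ?N) \<le> rank (?M r) + rank ?N" by (rule rank_subadditive) auto
  ultimately show ?case using Suc by simp
qed

text \<open>Every column is expanded in a maximal independent set of columns, which has
  \<open>rank C\<close> elements.\<close>

lemma (in vec_space) rank_factor:
  assumes C: "C \<in> carrier_mat n nc"
  obtains f g where "\<And>i j. i < n \<Longrightarrow> j < nc \<Longrightarrow> C $$ (i, j) = (\<Sum>k<rank C. f k i * g k j)"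
proof -
  let ?P = "\<lambda>T. T \<subseteq> set (cols C) \<and> lin_indpt T"
  have "lin_indpt {}" by (rule finite_lin_indpt2) auto
  then obtain S where S: "maximal S ?P" "finite S"
    using maximal_exists_superset[of "set (cols C)" ?P "{}"] by auto
  have cols: "set (cols C) \<subseteq> carrier_vec n" using C cols_dim by blast
  have Sc: "S \<subseteq> set (cols C)" "lin_indpt S" using S(1) by (auto simp: maximal_def)
  have Sn: "S \<subseteq> carrier_vec n" using Sc cols by blast
  have card: "rank C = card S" by (rule rank_card_indpt[OF C S(1)])
  have "\<exists>a. \<forall>i<n. C $$ (i, j) = (\<Sum>v\<in>S. a v * v $ i)" if j: "j < nc" for j
  proof -
    have cj: "col C j \<in> set (cols C)" using j C by (auto simp: cols_def)
    have "col C j \<in> span S"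
    proof (rule ccontr)
      assume "col C j \<notin> span S"
      moreover from this have "col C j \<notin> S" using in_own_span[of S] Sn by auto
      ultimately have "lin_indpt (S \<union> {col C j})"
        using lin_dep_iff_in_span[of S "col C j"] Sn Sc(2) cj cols by auto
      moreover have "S \<union> {col C j} \<subseteq> set (cols C)" using cj Sc(1) by blast
      ultimately have "S \<union> {col C j} = S" using S(1) unfolding maximal_def by blast
      then show False using \<open>col C j \<notin> S\<close> by blast
    qed
    from finite_in_span[OF S(2) _ this] Sn obtain a where a: "lincomb a S = col C j" by auto
    have "C $$ (i, j) = (\<Sum>v\<in>S. a v * v $ i)" if "i < n" for i
      using lincomb_index[OF that Sn, of a] a C j that by simp
    then show ?thesis by blast
  qed
  then obtain a where a: "\<And>i j. i < n \<Longrightarrow> j < nc \<Longrightarrow> C $$ (i, j) = (\<Sum>v\<in>S. a j v * v $ i)" by metis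
  obtain e where e: "bij_betw e {..<card S} S"
    using ex_bij_betw_nat_finite[OF S(2)] by (auto simp: atLeast0LessThan)
  have "C $$ (i, j) = (\<Sum>k<rank C. e k $ i * a j (e k))" if "i < n" "j < nc" for i j
    unfolding a[OF that] card sum.reindex_bij_betw[OF e, symmetric] by (simp add: mult.commute)
  then show thesis by (rule that)
qed

text \<open>Factorizations mediate between the two notions: one of length \<open>rank C\<close>
  bounds every dual system, and one of length below \<open>R\<close>, present when no dual system of
  size \<open>R\<close> exists, bounds the column rank.\<close>

lemma rank_ge_iff_rank:
  fixes C :: "'k::field mat"
  assumes C: "C \<in> carrier_mat nr nc"
  shows "rank_ge {..<nr} {..<nc} (\<lambda>i j. C $$ (i, j)) R \<longleftrightarrow> R \<le> vec_space.rank nr C"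
proof -
  interpret vec_space "TYPE('k)" nr .
  let ?H = "\<lambda>i j. C $$ (i, j)"
  show ?thesis
  proof
    assume "rank_ge {..<nr} {..<nc} ?H R"
    then obtain U W where D: "dual_system {..<nr} {..<nc} ?H R U W" using rank_ge_def by blast
    obtain f g where fg: "\<And>i j. i < nr \<Longrightarrow> j < nc \<Longrightarrow> C $$ (i, j) = (\<Sum>k<rank C. f k i * g k j)"
      using rank_factor[OF C] by blast
    have "pairing {..<nr} {..<nc} ?H u w = (\<Sum>k<rank C. (\<Sum>i<nr. u i * f k i) * (\<Sum>j<nc. g k j * w j))" for u w
    proof -
      have "pairing {..<nr} {..<nc} ?H u w = (\<Sum>i<nr. \<Sum>j<nc. \<Sum>k<rank C. u i * f k i * (g k j * w j))"
        unfolding pairing_def by (intro sum.cong refl) (simp add: fg sum_distrib_left sum_distrib_right mult.assoc)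
      also have "\<dots> = (\<Sum>k<rank C. \<Sum>i<nr. \<Sum>j<nc. u i * f k i * (g k j * w j))"
        by (simp only: sum.swap[of _ "{..<rank C}"])
      finally show ?thesis by (simp add: sum_product)
    qed
    from dual_system_factor_bound[OF D this] show "R \<le> rank C" .
  next
    assume R: "R \<le> rank C"
    show "rank_ge {..<nr} {..<nc} ?H R"
    proof (rule ccontr)
      assume neg: "\<not> rank_ge {..<nr} {..<nc} ?H R"
      obtain r U W where r: "r < R" and "dual_system {..<nr} {..<nc} ?H r U W"
        and fac: "\<forall>u w. pairing {..<nr} {..<nc} ?H u w =
          (\<Sum>i<r. pairing {..<nr} {..<nc} ?H u (W i) * pairing {..<nr} {..<nc} ?H (U i) w)"
        using rank_le_factorization[OF neg] by (elim exE conjE)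
      \<comment> \<open>Pairing unit vectors reads off the entries, which turns the factorization of
        the form into one of the matrix.\<close>
      define \<delta> where "\<delta> i = (\<lambda>j. if j = i then 1 else 0 :: 'k)" for i :: nat
      have \<delta>: "pairing {..<nr} {..<nc} ?H (\<delta> i) (\<delta> j) = C $$ (i, j)" if "i < nr" "j < nc" for i j
      proof -
        have "pairing {..<nr} {..<nc} ?H (\<delta> i) (\<delta> j) = (\<Sum>a<nr. if a = i then C $$ (a, j) else 0)"
          unfolding pairing_def
        proof (rule sum.cong[OF refl])
          fix a
          have "(\<Sum>b<nc. \<delta> i a * C $$ (a, b) * \<delta> j b) = (\<Sum>b<nc. if b = j then \<delta> i a * C $$ (a, b) else 0)"
            by (rule sum.cong) (auto simp: \<delta>_def)
          then show "(\<Sum>b<nc. \<delta> i a * C $$ (a, b) * \<delta> j b) = (if a = i then C $$ (a, j) else 0)"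
            using that by (simp add: \<delta>_def)
        qed
        then show ?thesis using that by simp
      qed
      define g where "g k j = pairing {..<nr} {..<nc} ?H (U k) (\<delta> j)" for k j
      define f where "f k i = pairing {..<nr} {..<nc} ?H (\<delta> i) (W k)" for k i
      have "C = mat nr nc (\<lambda>(i, j). \<Sum>k<r. f k i * g k j)"
        using C by (intro eq_matI) (simp_all add: \<delta> f_def g_def fac[rule_format, symmetric])
      then have "rank C \<le> r" using rank_outer_sum_le[of nc f g r] by simp
      then show False using r R by simp
    qed
  qed
qed

lemma rank_ge_hom:
  fixes h :: "'a::field \<Rightarrow> 'b::field"
  assumes h: "h 0 = 0" "h 1 = 1" "\<And>x y. h (x + y) = h x + h y" "\<And>x y. h (x * y) = h x * h y"
    and "rank_ge A B H R"
  shows "rank_ge A B (\<lambda>a b. h (H a b)) R"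
proof -
  obtain U W where D: "dual_system A B H R U W" using assms(5) rank_ge_def by blast
  have sum: "h (sum f X) = (\<Sum>x\<in>X. h (f x))" for f :: "'z \<Rightarrow> 'a" and X
    using h by (induction X rule: infinite_finite_induct) simp_all
  have "dual_system A B (\<lambda>a b. h (H a b)) R (\<lambda>i a. h (U i a)) (\<lambda>i b. h (W i b))"
    unfolding dual_system_def
  proof (intro allI impI)
    fix i j assume "i < R" "j < R"
    then have "h (pairing A B H (U i) (W j)) = (if i = j then 1 else 0)"
      using D h by (simp add: dual_system_def)
    then show "pairing A B (\<lambda>a b. h (H a b)) (\<lambda>a. h (U i a)) (\<lambda>b. h (W j b)) = (if i = j then 1 else 0)"
      by (simp add: pairing_def sum h)
  qed
  then show ?thesis using rank_ge_def by blast
qed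

subsection \<open>Transmission and the system matrix\<close>

lemma invertible_mat_iff_det:
  fixes M :: "'f::field mat"
  assumes M: "M \<in> carrier_mat n n"
  shows "invertible_mat M \<longleftrightarrow> det M \<noteq> 0"
proof
  assume "invertible_mat M"
  then obtain B where B: "M * B = 1\<^sub>m (dim_row M)" "B * M = 1\<^sub>m (dim_row B)"
    unfolding invertible_mat_def inverts_mat_def by blast
  \<comment> \<open>\<open>invertible_mat\<close> does not prescribe the shape of \<open>B\<close>;
    comparing dimensions in the two products recovers it.\<close>
  have "dim_col B = n" using arg_cong[OF B(1), of dim_col] M by simp
  moreover have "dim_row B = n" using arg_cong[OF B(2), of dim_col] M by simp
  ultimately have "B \<in> carrier_mat n n" by auto
  then have "det M * det B = 1" using det_mult[OF M] B(1) M by (metis carrier_matD(1) det_one)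
  then show "det M \<noteq> 0" by auto
next
  assume "det M \<noteq> 0"
  from det_non_zero_imp_unit[OF M this, unfolded Units_def, of undefined] obtain B where
    "B \<in> carrier_mat n n" "B * M = 1\<^sub>m n" "M * B = 1\<^sub>m n" by (auto simp: ring_mat_def)
  then show "invertible_mat M" using M unfolding invertible_mat_def inverts_mat_def by auto
qed

text \<open>The entries of \<open>F_matrix\<close> addressed by ports instead of list
  positions.\<close>

definition port_coeff :: "('v, 'p) network \<Rightarrow> ('p \<Rightarrow> 'p \<Rightarrow> 'f::field) \<Rightarrow> 'p \<Rightarrow> 'p \<Rightarrow> 'f" where
  "port_coeff G \<beta> p q = (if (p, q) \<in> edges G then 1
     else if \<exists>v\<in>nodes G. p \<in> inports G v \<and> q \<in> outports G v then \<beta> p q else 0)"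

lemma finite_ports: "is_network G \<Longrightarrow> finite (ports G)"
  by (auto simp: is_network_def ports_def)

lemma inport_outport_disjoint:
  "is_network G \<Longrightarrow> v \<in> nodes G \<Longrightarrow> w \<in> nodes G \<Longrightarrow> p \<in> inports G v \<Longrightarrow> p \<notin> outports G w"
  unfolding is_network_def by blast

lemma inport_unique:
  "is_network G \<Longrightarrow> v \<in> nodes G \<Longrightarrow> w \<in> nodes G \<Longrightarrow> p \<in> inports G v \<Longrightarrow> p \<in> inports G w \<Longrightarrow> v = w"
  unfolding is_network_def by (metis disjoint_iff)

lemma outport_unique:
  "is_network G \<Longrightarrow> v \<in> nodes G \<Longrightarrow> w \<in> nodes G \<Longrightarrow> p \<in> outports G v \<Longrightarrow> p \<in> outports G w \<Longrightarrow> v = w"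
  unfolding is_network_def by (metis disjoint_iff)

lemma edge_ports:
  assumes "is_network G" "(p, q) \<in> edges G"
  obtains v w where "v \<in> nodes G" "w \<in> nodes G" "p \<in> outports G v" "q \<in> inports G w"
  using assms unfolding is_network_def by blast

lemma edge_sources:
  assumes "is_network G"
  shows "{p. (p, q) \<in> edges G} \<subseteq> ports G" "finite {p. (p, q) \<in> edges G}"
proof -
  show sub: "{p. (p, q) \<in> edges G} \<subseteq> ports G"
  proof
    fix p assume "p \<in> {p. (p, q) \<in> edges G}"
    then obtain v where "v \<in> nodes G" "p \<in> outports G v" using edge_ports[OF assms] by blast
    then show "p \<in> ports G" by (auto simp: ports_def)
  qed
  show "finite {p. (p, q) \<in> edges G}" using sub finite_ports[OF assms] by (rule finite_subset)
qed

lemma sum_port_coeff_out: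
  assumes N: "is_network G" and v: "v \<in> nodes G" and q: "q \<in> outports G v"
  shows "(\<Sum>p\<in>ports G. port_coeff G \<beta> p q * Y p) = (\<Sum>p\<in>inports G v. \<beta> p q * Y p)"
proof (rule sum.mono_neutral_cong_right)
  show "finite (ports G)" using N by (rule finite_ports)
  show "inports G v \<subseteq> ports G" using v by (auto simp: ports_def)
  have nE: "(p, q) \<notin> edges G" for p
    using edge_ports[OF N] inport_outport_disjoint[OF N _ v] q by metis
  show "\<forall>p\<in>ports G - inports G v. port_coeff G \<beta> p q * Y p = 0"
    using outport_unique[OF N v _ q] nE by (auto simp: port_coeff_def)
  show "port_coeff G \<beta> p q * Y p = \<beta> p q * Y p" if "p \<in> inports G v" for p
    using that v q nE by (auto simp: port_coeff_def)
qed

lemma sum_port_coeff_in: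
  assumes N: "is_network G" and v: "v \<in> nodes G" and q: "q \<in> inports G v"
  shows "(\<Sum>p\<in>ports G. port_coeff G \<beta> p q * Y p) = (\<Sum>p | (p, q) \<in> edges G. Y p)"
proof (rule sum.mono_neutral_cong_right)
  show "finite (ports G)" using N by (rule finite_ports)
  show "{p. (p, q) \<in> edges G} \<subseteq> ports G"
    by (rule edge_sources[OF N])
  show "\<forall>p\<in>ports G - {p. (p, q) \<in> edges G}. port_coeff G \<beta> p q * Y p = 0"
    using inport_outport_disjoint[OF N v _ q] by (auto simp: port_coeff_def)
qed (auto simp: port_coeff_def)

text \<open>Every port has one kind and one owner, so the separate rules for input and output ports
  merge into one linear system over all ports.\<close>

lemma transmission_iff:
  assumes N: "is_network G" and S: "S \<in> nodes G"
  shows "transmission G S R \<alpha> \<beta> X Y \<longleftrightarrow> (\<forall>q\<in>ports G. Y q =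
    (\<Sum>p\<in>ports G. port_coeff G \<beta> p q * Y p) + (if q \<in> outports G S then \<Sum>i<R. \<alpha> i q * X i else 0))"
    (is "_ \<longleftrightarrow> (\<forall>q\<in>_. ?eq q)")
proof -
  have out: "?eq q \<longleftrightarrow> Y q = (\<Sum>p\<in>inports G v. \<beta> p q * Y p) + (if v = S then \<Sum>i<R. \<alpha> i q * X i else 0)"
    if "v \<in> nodes G" "q \<in> outports G v" for v q
  proof -
    have "q \<in> outports G S \<longleftrightarrow> v = S" using outport_unique[OF N that(1) S that(2)] that(2) by blast
    then show ?thesis by (simp add: sum_port_coeff_out[OF N that])
  qed
  have inp: "?eq q \<longleftrightarrow> Y q = (\<Sum>p | (p, q) \<in> edges G. Y p)" if "v \<in> nodes G" "q \<in> inports G v" for v q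
    using inport_outport_disjoint[OF N that(1) S that(2)] by (simp add: sum_port_coeff_in[OF N that])
  have "(\<forall>q\<in>ports G. ?eq q) \<longleftrightarrow>
    (\<forall>v\<in>nodes G. \<forall>q\<in>outports G v. ?eq q) \<and> (\<forall>v\<in>nodes G. \<forall>q\<in>inports G v. ?eq q)"
    unfolding ports_def by blast
  then show ?thesis unfolding transmission_def by (simp only: out inp cong: ball_cong)
qed

section \<open>Propagation of zeros in an acyclic network\<close>

lemma finite_node_arcs: "is_network G \<Longrightarrow> finite (node_arcs G)"
  by (rule finite_subset[of _ "nodes G \<times> nodes G"]) (auto simp: node_arcs_def is_network_def)

text \<open>Well-founded induction along the arcs: a node of \<open>D\<close> receives zero in total
  from outside by \<open>cut\<close>, and zero from its predecessors in \<open>D\<close>. Taking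
  \<open>D\<close> as the far side of a cut gives the bound on the rate; taking all nodes gives
  uniqueness.\<close>

lemma downstream_zero:
  assumes N: "is_network G" and ac: "acyclic_network G"
    and tr: "transmission G S R \<alpha> \<beta> X Y"
    and D: "D \<subseteq> nodes G" "S \<in> D \<Longrightarrow> \<forall>i<R. X i = 0"
    and cut: "\<And>v q. v \<in> D \<Longrightarrow> q \<in> inports G v \<Longrightarrow>
      (\<Sum>p\<in>{p. (p, q) \<in> edges G} \<inter> (\<Union>w\<in>nodes G - D. outports G w). Y p) = 0"
    and "v \<in> D" "p \<in> inports G v \<union> outports G v"
  shows "Y p = 0"
proof -
  have "wf (node_arcs G)"
    using finite_acyclic_wf[OF finite_node_arcs[OF N]] ac by (simp add: acyclic_network_def)
  then show ?thesis using assms(7,8)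
  proof (induction v arbitrary: p rule: wf_induct_rule)
    case (less v)
    have v: "v \<in> nodes G" using less(2) D(1) by blast
    have inp: "Y q = 0" if q: "q \<in> inports G v" for q
    proof -
      have fin: "finite {p. (p, q) \<in> edges G}"
        by (rule edge_sources[OF N])
      have "Y p = 0" if p: "(p, q) \<in> edges G" "p \<notin> (\<Union>w\<in>nodes G - D. outports G w)" for p
      proof -
        obtain w where w: "w \<in> nodes G" "p \<in> outports G w" using edge_ports[OF N p(1)] by metis
        then have "w \<in> D" using p(2) by blast
        moreover have "(w, v) \<in> node_arcs G" using w v p(1) q by (auto simp: node_arcs_def)
        ultimately show ?thesis using less(1)[of w p] w by blast
      qed
      then have "(\<Sum>p | (p, q) \<in> edges G. Y p)
          = (\<Sum>p\<in>{p. (p, q) \<in> edges G} \<inter> (\<Union>w\<in>nodes G - D. outports G w). Y p)"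
        using fin by (intro sum.mono_neutral_right) auto
      then show ?thesis using cut[OF less(2) q] tr v q by (simp add: transmission_def)
    qed
    show ?case
    proof (cases "p \<in> inports G v")
      case False
      then have "p \<in> outports G v" using less(3) by blast
      then have "Y p = (\<Sum>q\<in>inports G v. \<beta> q p * Y q) + (if v = S then \<Sum>i<R. \<alpha> i p * X i else 0)"
        using tr v unfolding transmission_def by blast
      moreover have "(\<Sum>i<R. \<alpha> i p * X i) = 0" if "v = S" using D(2) that less(2) by simp
      ultimately show ?thesis using inp by simp
    qed (rule inp)
  qed
qed

text \<open>With \<open>D = nodes G\<close> nothing lies outside \<open>D\<close> and the cut
  condition is an empty sum. By linearity this is uniqueness of the port symbols.\<close>

lemma transmission_zero:
  assumes "is_network G" "acyclic_network G" "transmission G S R \<alpha> \<beta> X Y"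
    and "\<forall>i<R. X i = 0" and "p \<in> ports G"
  shows "Y p = 0"
proof -
  obtain v where "v \<in> nodes G" "p \<in> inports G v \<union> outports G v"
    using assms(5) by (auto simp: ports_def)
  then show ?thesis
    using downstream_zero[OF assms(1-3), of "nodes G" v p] assms(4) by simp
qed

lemma sum_nth:
  assumes "distinct es"
  shows "(\<Sum>i<length es. f (es ! i)) = (\<Sum>p\<in>set es. f p)"
  by (rule sum.reindex_bij_betw[OF bij_betw_nth[OF assms]]) auto

definition port_vec :: "'p list \<Rightarrow> ('p \<Rightarrow> 'f) \<Rightarrow> 'f vec" where
  "port_vec es Y = vec (length es) (\<lambda>i. Y (es ! i))"

lemma port_vec_surj:
  assumes "distinct es" "y \<in> carrier_vec (length es)"
  obtains Y where "y = port_vec es Y"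
proof -
  have "port_vec es (\<lambda>p. y $ (THE i. i < length es \<and> es ! i = p)) = y"
  proof (rule eq_vecI)
    fix i assume "i < dim_vec y"
    then have i: "i < length es" using assms(2) by simp
    then have "(THE j. j < length es \<and> es ! j = es ! i) = i"
      using nth_eq_iff_index_eq[OF assms(1)] by (intro the_equality) auto
    then show "port_vec es (\<lambda>p. y $ (THE i. i < length es \<and> es ! i = p)) $ i = y $ i"
      using i by (simp add: port_vec_def)
  qed (use assms(2) in \<open>simp add: port_vec_def\<close>)
  then show thesis using that by metis
qed

section \<open>Transmission in matrix form\<close>

locale coded_network =
  fixes G :: "('v, 'p) network" and es :: "'p list" and S T :: 'v and R :: nat
  assumes network: "is_network G" and acyclic: "acyclic_network G"
    and es: "distinct es" "set es = ports G" and S: "S \<in> nodes G" and T: "T \<in> nodes G"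
begin

lemma system_carrier:
  "A_matrix G es S R \<alpha> \<in> carrier_mat R (length es)"
  "B_matrix G es T R \<epsilon> \<in> carrier_mat R (length es)"
  "F_matrix G es \<beta> \<in> carrier_mat (length es) (length es)"
  by (simp_all add: A_matrix_def B_matrix_def F_matrix_def)

text \<open>The system matrix acts on row vectors; with column vectors the matrices on both sides
  appear transposed.\<close>

lemma transmission_iff_vec:
  "transmission G S R \<alpha> \<beta> X Y \<longleftrightarrow>
   transpose_mat (1\<^sub>m (length es) - F_matrix G es \<beta>) *\<^sub>v port_vec es Y =
   transpose_mat (A_matrix G es S R \<alpha>) *\<^sub>v vec R X" (is "_ \<longleftrightarrow> ?l = ?r")
proof -
  let ?n = "length es"
  have l: "?l $ j = Y (es ! j) - (\<Sum>p\<in>ports G. port_coeff G \<beta> p (es ! j) * Y p)" if "j < ?n" for j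
  proof -
    have "?l $ j = (\<Sum>i<?n. ((if i = j then 1 else 0) - port_coeff G \<beta> (es ! i) (es ! j)) * Y (es ! i))"
      using that by (auto simp: scalar_prod_def port_vec_def F_matrix_def port_coeff_def atLeast0LessThan
          intro!: sum.cong)
    also have "\<dots> = (\<Sum>i<?n. (if i = j then Y (es ! i) else 0) - port_coeff G \<beta> (es ! i) (es ! j) * Y (es ! i))"
      by (intro sum.cong) (auto simp: algebra_simps)
    also have "\<dots> = Y (es ! j) - (\<Sum>i<?n. port_coeff G \<beta> (es ! i) (es ! j) * Y (es ! i))"
      using that by (simp add: sum_subtractf)
    finally show ?thesis using sum_nth[OF es(1), of "\<lambda>p. port_coeff G \<beta> p (es ! j) * Y p"] es(2) by simp
  qed
  have r: "?r $ j = (if es ! j \<in> outports G S then \<Sum>i<R. \<alpha> i (es ! j) * X i else 0)" if "j < ?n" for j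
    using that by (auto simp: scalar_prod_def A_matrix_def atLeast0LessThan intro!: sum.cong)
  have dims: "dim_vec ?l = ?n" "dim_vec ?r = ?n" by (simp_all add: F_matrix_def A_matrix_def)
  have "?l = ?r \<longleftrightarrow> (\<forall>j<?n. ?l $ j = ?r $ j)" using eq_vecI[of ?r ?l] dims by metis
  also have "\<dots> \<longleftrightarrow> (\<forall>q\<in>set es. Y q = (\<Sum>p\<in>ports G. port_coeff G \<beta> p q * Y p) +
      (if q \<in> outports G S then \<Sum>i<R. \<alpha> i q * X i else 0))"
    unfolding all_set_conv_all_nth by (auto simp: l r algebra_simps)
  finally show ?thesis unfolding transmission_iff[OF network S] es(2)[symmetric] by (rule sym)
qed

lemma decoded_vec:
  "vec R (decoded G T \<epsilon> Y) = B_matrix G es T R \<epsilon> *\<^sub>v port_vec es Y"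
proof (rule eq_vecI)
  fix k assume "k < dim_vec (B_matrix G es T R \<epsilon> *\<^sub>v port_vec es Y)"
  then have k: "k < R" by (simp add: B_matrix_def)
  have "(B_matrix G es T R \<epsilon> *\<^sub>v port_vec es Y) $ k
      = (\<Sum>i<length es. (if es ! i \<in> inports G T then \<epsilon> (es ! i) k else 0) * Y (es ! i))"
    using k by (auto simp: scalar_prod_def port_vec_def B_matrix_def atLeast0LessThan intro!: sum.cong)
  also have "\<dots> = (\<Sum>p\<in>set es. (if p \<in> inports G T then \<epsilon> p k else 0) * Y p)"
    by (rule sum_nth[OF es(1)])
  also have "\<dots> = (\<Sum>p\<in>inports G T. \<epsilon> p k * Y p)"
  proof (rule sum.mono_neutral_cong_right)
    show "inports G T \<subseteq> set es" using T unfolding es(2) ports_def by blast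
    show "finite (set es)" by simp
  qed auto
  finally show "vec R (decoded G T \<epsilon> Y) $ k = (B_matrix G es T R \<epsilon> *\<^sub>v port_vec es Y) $ k"
    using k by (simp add: decoded_def)
qed (simp add: B_matrix_def)

text \<open>A kernel vector of the transpose is a transmission with silent source, which acyclicity
  forces to be 0. Hence \<open>mat_inverse\<close> succeeds and \<open>the\<close> in
  \<open>system_matrix\<close> is harmless.\<close>

lemma inverse_of_one_minus_F:
  fixes \<beta> :: "'p \<Rightarrow> 'p \<Rightarrow> 'f::field"
  obtains N where "mat_inverse (1\<^sub>m (length es) - F_matrix G es \<beta>) = Some N"
    "N \<in> carrier_mat (length es) (length es)"
    "N * (1\<^sub>m (length es) - F_matrix G es \<beta>) = 1\<^sub>m (length es)"
    "(1\<^sub>m (length es) - F_matrix G es \<beta>) * N = 1\<^sub>m (length es)"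
proof -
  let ?n = "length es" and ?Q = "1\<^sub>m (length es) - F_matrix G es \<beta>"
  have Q: "?Q \<in> carrier_mat ?n ?n" by (rule minus_carrier_mat[OF system_carrier(3)])
  have "det (transpose_mat ?Q) \<noteq> 0"
  proof
    assume "det (transpose_mat ?Q) = 0"
    then obtain y where y: "y \<in> carrier_vec ?n" "y \<noteq> 0\<^sub>v ?n" "transpose_mat ?Q *\<^sub>v y = 0\<^sub>v ?n"
      using det_0_iff_vec_prod_zero_field[of "transpose_mat ?Q" ?n] Q by auto
    obtain Y where Y: "y = port_vec es Y" using port_vec_surj[OF es(1) y(1)] .
    have "transpose_mat (A_matrix G es S R (\<lambda>_ _. 0)) *\<^sub>v vec R (\<lambda>_. 0 :: 'f) = 0\<^sub>v ?n"
      by (intro eq_vecI) (auto simp: A_matrix_def scalar_prod_def)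
    then have "transmission G S R (\<lambda>_ _. 0) \<beta> (\<lambda>_. 0) Y"
      using y(3) Y by (simp add: transmission_iff_vec)
    then have "Y p = 0" if "p \<in> set es" for p
      using transmission_zero[OF network acyclic] es(2) that by blast
    then have "y = 0\<^sub>v ?n" unfolding Y port_vec_def by (intro eq_vecI) auto
    then show False using y(2) by simp
  qed
  then have "det ?Q \<noteq> 0" using det_transpose[OF Q] by simp
  then have U: "?Q \<in> Units (ring_mat TYPE('f) ?n undefined)" by (rule det_non_zero_imp_unit[OF Q])
  show thesis
  proof (cases "mat_inverse ?Q")
    case None
    then show ?thesis using mat_inverse(1)[OF Q, of undefined] U by blast
  next
    case (Some N)
    then show ?thesis using mat_inverse(2)[OF Q Some] that by blast
  qed
qed

lemma system_matrix_carrier: "system_matrix G es S T R \<alpha> \<beta> \<epsilon> \<in> carrier_mat R R"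
  unfolding system_matrix_def by (intro carrier_matI) (simp_all add: A_matrix_def B_matrix_def)

text \<open>The transposed inverse applied to the source term solves the equations. This keeps
  statements about all transmissions from being vacuous.\<close>

lemma transmission_exists: "\<exists>Y. transmission G S R \<alpha> \<beta> X Y"
proof -
  obtain N where N: "N \<in> carrier_mat (length es) (length es)"
    "N * (1\<^sub>m (length es) - F_matrix G es \<beta>) = 1\<^sub>m (length es)"
    by (rule inverse_of_one_minus_F[of \<beta>])
  let ?n = "length es" and ?Q = "1\<^sub>m (length es) - F_matrix G es \<beta>"
  let ?a = "transpose_mat (A_matrix G es S R \<alpha>) *\<^sub>v vec R X"
  have Q: "?Q \<in> carrier_mat ?n ?n" by (rule minus_carrier_mat[OF system_carrier(3)])
  have a: "?a \<in> carrier_vec ?n" using system_carrier(1)[of \<alpha>] by (intro carrier_vecI) simp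
  have "transpose_mat N *\<^sub>v ?a \<in> carrier_vec ?n" using N by (intro carrier_vecI) simp
  then obtain Y where Y: "transpose_mat N *\<^sub>v ?a = port_vec es Y" using port_vec_surj[OF es(1)] by blast
  have "transpose_mat ?Q *\<^sub>v (transpose_mat N *\<^sub>v ?a) = (transpose_mat ?Q * transpose_mat N) *\<^sub>v ?a"
    using Q N(1) a by (intro assoc_mult_mat_vec[symmetric, where ?n\<^sub>1 = ?n and ?n\<^sub>2 = ?n and ?n\<^sub>3 = ?n]) auto
  also have "transpose_mat ?Q * transpose_mat N = 1\<^sub>m ?n"
    using transpose_mult[OF N(1) Q] N(2) by simp
  finally have "transpose_mat ?Q *\<^sub>v port_vec es Y = ?a" using a Y by simp
  then show ?thesis by (auto simp only: transmission_iff_vec)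
qed

lemma transmission_system_matrix:
  assumes "transmission G S R \<alpha> \<beta> X Y"
  shows "transpose_mat (system_matrix G es S T R \<alpha> \<beta> \<epsilon>) *\<^sub>v vec R X = vec R (decoded G T \<epsilon> Y)"
proof -
  obtain N where N: "mat_inverse (1\<^sub>m (length es) - F_matrix G es \<beta>) = Some N"
    "N \<in> carrier_mat (length es) (length es)"
    "(1\<^sub>m (length es) - F_matrix G es \<beta>) * N = 1\<^sub>m (length es)"
    by (rule inverse_of_one_minus_F[of \<beta>])
  let ?n = "length es" and ?Q = "1\<^sub>m (length es) - F_matrix G es \<beta>"
  let ?A = "A_matrix G es S R \<alpha>" and ?B = "B_matrix G es T R \<epsilon>"
  have Q: "?Q \<in> carrier_mat ?n ?n" by (rule minus_carrier_mat[OF system_carrier(3)])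
  note A = system_carrier(1)[of \<alpha>] and B = system_carrier(2)[of \<epsilon>]
  have y: "port_vec es Y \<in> carrier_vec ?n" by (simp add: port_vec_def)
  have x: "vec R X \<in> carrier_vec R" by simp
  have eq: "transpose_mat ?Q *\<^sub>v port_vec es Y = transpose_mat ?A *\<^sub>v vec R X"
    using assms transmission_iff_vec by blast
  have "transpose_mat (?A * N * transpose_mat ?B) = ?B * (transpose_mat N * transpose_mat ?A)"
    using transpose_mult[of "?A * N" R ?n "transpose_mat ?B" R] transpose_mult[OF A N(2)] A B N(2) by auto
  then have "transpose_mat (system_matrix G es S T R \<alpha> \<beta> \<epsilon>) *\<^sub>v vec R X
      = (?B * (transpose_mat N * transpose_mat ?A)) *\<^sub>v vec R X"
    by (simp add: system_matrix_def N(1))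
  also have "\<dots> = ?B *\<^sub>v (transpose_mat N *\<^sub>v (transpose_mat ?A *\<^sub>v vec R X))"
    using A B N(2) x by (simp add: assoc_mult_mat_vec[where ?n\<^sub>1 = R and ?n\<^sub>2 = ?n and ?n\<^sub>3 = R]
        assoc_mult_mat_vec[where ?n\<^sub>1 = ?n and ?n\<^sub>2 = ?n and ?n\<^sub>3 = R])
  also have "transpose_mat N *\<^sub>v (transpose_mat ?A *\<^sub>v vec R X)
      = (transpose_mat N * transpose_mat ?Q) *\<^sub>v port_vec es Y"
    unfolding eq[symmetric] using Q N(2) y
    by (intro assoc_mult_mat_vec[symmetric, where ?n\<^sub>1 = ?n and ?n\<^sub>2 = ?n and ?n\<^sub>3 = ?n]) auto
  also have "transpose_mat N * transpose_mat ?Q = 1\<^sub>m ?n"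
    using transpose_mult[OF Q N(2)] N(3) by simp
  finally show ?thesis using y by (simp add: decoded_vec)
qed

text \<open>Injectivity in place of exact recovery: kernel arguments apply to it directly, and
  recovery is regained by adjusting the decoder.\<close>

definition decodable ::
  "(nat \<Rightarrow> 'p \<Rightarrow> 'f) \<Rightarrow> ('p \<Rightarrow> 'p \<Rightarrow> 'f) \<Rightarrow> ('p \<Rightarrow> nat \<Rightarrow> 'f::field) \<Rightarrow> bool" where
  "decodable \<alpha> \<beta> \<epsilon> \<longleftrightarrow> (\<forall>X Y. transmission G S R \<alpha> \<beta> X Y \<longrightarrow>
     (\<forall>k<R. decoded G T \<epsilon> Y k = 0) \<longrightarrow> (\<forall>i<R. X i = 0))"

lemma invertible_iff_decodable:
  fixes \<alpha> :: "nat \<Rightarrow> 'p \<Rightarrow> 'f::field"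
  shows "invertible_mat (system_matrix G es S T R \<alpha> \<beta> \<epsilon>) \<longleftrightarrow> decodable \<alpha> \<beta> \<epsilon>"
proof -
  let ?M = "system_matrix G es S T R \<alpha> \<beta> \<epsilon>"
  have Mt: "transpose_mat ?M \<in> carrier_mat R R" using system_matrix_carrier by simp
  have "invertible_mat ?M \<longleftrightarrow> det (transpose_mat ?M) \<noteq> 0"
    using invertible_mat_iff_det[OF system_matrix_carrier] det_transpose[OF system_matrix_carrier] by metis
  also have "\<dots> \<longleftrightarrow> (\<forall>x\<in>carrier_vec R. transpose_mat ?M *\<^sub>v x = 0\<^sub>v R \<longrightarrow> x = 0\<^sub>v R)"
    using det_0_iff_vec_prod_zero_field[OF Mt] by blast
  also have "\<dots> \<longleftrightarrow> decodable \<alpha> \<beta> \<epsilon>"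
  proof
    assume inj: "\<forall>x\<in>carrier_vec R. transpose_mat ?M *\<^sub>v x = 0\<^sub>v R \<longrightarrow> x = 0\<^sub>v R"
    show "decodable \<alpha> \<beta> \<epsilon>" unfolding decodable_def
    proof (intro allI impI)
      fix X Y i assume tr: "transmission G S R \<alpha> \<beta> X Y" and z: "\<forall>k<R. decoded G T \<epsilon> Y k = 0" and i: "i < R"
      have "vec R (decoded G T \<epsilon> Y) = 0\<^sub>v R" using z by (intro eq_vecI) auto
      then have "vec R X = 0\<^sub>v R" using inj transmission_system_matrix[OF tr] by auto
      then show "X i = 0" using i by (metis index_vec index_zero_vec(1))
    qed
  next
    assume dec: "decodable \<alpha> \<beta> \<epsilon>"
    show "\<forall>x\<in>carrier_vec R. transpose_mat ?M *\<^sub>v x = 0\<^sub>v R \<longrightarrow> x = 0\<^sub>v R"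
    proof (intro ballI impI)
      fix x assume x: "x \<in> carrier_vec R" and 0: "transpose_mat ?M *\<^sub>v x = 0\<^sub>v R"
      define X where "X i = x $ i" for i
      have X: "vec R X = x" using x by (intro eq_vecI) (auto simp: X_def)
      obtain Y where tr: "transmission G S R \<alpha> \<beta> X Y" using transmission_exists by blast
      have "vec R (decoded G T \<epsilon> Y) = 0\<^sub>v R" using transmission_system_matrix[OF tr] 0 X by metis
      then have "\<forall>k<R. decoded G T \<epsilon> Y k = 0" by (metis index_vec index_zero_vec(1))
      then have "\<forall>i<R. X i = 0" using dec tr unfolding decodable_def by blast
      then show "x = 0\<^sub>v R" using x by (intro eq_vecI) (auto simp: X_def)
    qed
  qed
  finally show ?thesis .
qed

lemma feasible_iff_invertible:
  "feasible TYPE('f::field) G S T R \<longleftrightarrow>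
   (\<exists>(\<alpha> :: nat \<Rightarrow> 'p \<Rightarrow> 'f) \<beta> \<epsilon>. invertible_mat (system_matrix G es S T R \<alpha> \<beta> \<epsilon>))"
proof
  assume "feasible TYPE('f) G S T R"
  then obtain \<alpha> :: "nat \<Rightarrow> 'p \<Rightarrow> 'f" and \<beta> \<epsilon> where
    f: "\<And>X Y k. transmission G S R \<alpha> \<beta> X Y \<Longrightarrow> k < R \<Longrightarrow> decoded G T \<epsilon> Y k = X k"
    unfolding feasible_def by blast
  have "decodable \<alpha> \<beta> \<epsilon>" unfolding decodable_def using f by (metis (no_types))
  then show "\<exists>(\<alpha> :: nat \<Rightarrow> 'p \<Rightarrow> 'f) \<beta> \<epsilon>. invertible_mat (system_matrix G es S T R \<alpha> \<beta> \<epsilon>)"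
    using invertible_iff_decodable by blast
next
  assume "\<exists>(\<alpha> :: nat \<Rightarrow> 'p \<Rightarrow> 'f) \<beta> \<epsilon>. invertible_mat (system_matrix G es S T R \<alpha> \<beta> \<epsilon>)"
  then obtain \<alpha> :: "nat \<Rightarrow> 'p \<Rightarrow> 'f" and \<beta> \<epsilon> where inv: "invertible_mat (system_matrix G es S T R \<alpha> \<beta> \<epsilon>)"
    by blast
  let ?M = "transpose_mat (system_matrix G es S T R \<alpha> \<beta> \<epsilon>)"
  have M: "?M \<in> carrier_mat R R" using system_matrix_carrier by simp
  have "det ?M \<noteq> 0"
    using inv invertible_mat_iff_det[OF system_matrix_carrier] det_transpose[OF system_matrix_carrier] by metis
  from det_non_zero_imp_unit[OF M this, unfolded Units_def, of undefined] obtain C where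
    C: "C \<in> carrier_mat R R" "C * ?M = 1\<^sub>m R" by (auto simp: ring_mat_def)
  \<comment> \<open>Absorbing the inverse of the transposed system matrix into the decoder turns the
    overall transfer into the identity.\<close>
  define \<epsilon>' where "\<epsilon>' p k = (\<Sum>l<R. C $$ (k, l) * \<epsilon> p l)" for p k
  have "decoded G T \<epsilon>' Y k = X k" if tr: "transmission G S R \<alpha> \<beta> X Y" and k: "k < R" for X Y k
  proof -
    have "decoded G T \<epsilon>' Y k = (\<Sum>p\<in>inports G T. \<Sum>l<R. C $$ (k, l) * (\<epsilon> p l * Y p))"
      by (simp add: decoded_def \<epsilon>'_def sum_distrib_right mult.assoc)
    also have "\<dots> = (\<Sum>l<R. C $$ (k, l) * decoded G T \<epsilon> Y l)"
      by (subst sum.swap) (simp add: decoded_def sum_distrib_left)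
    also have "\<dots> = (C *\<^sub>v vec R (decoded G T \<epsilon> Y)) $ k"
      using C(1) k by (auto simp: scalar_prod_def atLeast0LessThan intro!: sum.cong)
    also have "vec R (decoded G T \<epsilon> Y) = ?M *\<^sub>v vec R X"
      using transmission_system_matrix[OF tr] by simp
    also have "C *\<^sub>v (?M *\<^sub>v vec R X) = (C * ?M) *\<^sub>v vec R X"
      using C(1) M by (intro assoc_mult_mat_vec[symmetric, where ?n\<^sub>1 = R and ?n\<^sub>2 = R and ?n\<^sub>3 = R]) auto
    finally show ?thesis using C(2) k by simp
  qed
  then show "feasible TYPE('f) G S T R"
    unfolding feasible_def using transmission_exists by blast
qed

end

subsection \<open>Cuts\<close>

definition edge_coeff :: "('v, 'p) network \<Rightarrow> 'p \<Rightarrow> 'p \<Rightarrow> 'f::field" where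
  "edge_coeff G p q = (if (p, q) \<in> edges G then 1 else 0)"

definition cut_ge :: "'f::field itself \<Rightarrow> ('v, 'p) network \<Rightarrow> nat \<Rightarrow> 'v set \<Rightarrow> bool" where
  "cut_ge _ G R \<Omega> \<longleftrightarrow> rank_ge (\<Union>v\<in>\<Omega>. outports G v) (\<Union>v\<in>nodes G - \<Omega>. inports G v)
     (edge_coeff G :: 'p \<Rightarrow> 'p \<Rightarrow> 'f) R"

lemma transmission_sum:
  assumes "\<And>i. i \<in> N \<Longrightarrow> transmission G S R \<alpha> \<beta> (X i) (Y i)"
  shows "transmission G S R \<alpha> \<beta> (\<lambda>j. \<Sum>i\<in>N. c i * X i j) (\<lambda>p. \<Sum>i\<in>N. c i * Y i p)"
proof -
  have "(\<Sum>i\<in>N. c i * Y i e) = (\<Sum>m\<in>inports G v. \<beta> m e * (\<Sum>i\<in>N. c i * Y i m)) +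
      (if v = S then \<Sum>j<R. \<alpha> j e * (\<Sum>i\<in>N. c i * X i j) else 0)"
    if "v \<in> nodes G" "e \<in> outports G v" for v e
  proof -
    have "Y i e = (\<Sum>m\<in>inports G v. \<beta> m e * Y i m) + (if v = S then \<Sum>j<R. \<alpha> j e * X i j else 0)"
      if "i \<in> N" for i
      using assms[OF that] \<open>v \<in> nodes G\<close> \<open>e \<in> outports G v\<close> unfolding transmission_def by blast
    then have "(\<Sum>i\<in>N. c i * Y i e) = (\<Sum>i\<in>N. c i * ((\<Sum>m\<in>inports G v. \<beta> m e * Y i m)
        + (if v = S then \<Sum>j<R. \<alpha> j e * X i j else 0)))"
      by (intro sum.cong refl) simp
    also have "\<dots> = (\<Sum>i\<in>N. \<Sum>m\<in>inports G v. \<beta> m e * (c i * Y i m))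
        + (if v = S then \<Sum>i\<in>N. \<Sum>j<R. \<alpha> j e * (c i * X i j) else 0)"
      by (simp add: distrib_left sum.distrib sum_distrib_left mult.left_commute)
    also have "\<dots> = (\<Sum>m\<in>inports G v. \<Sum>i\<in>N. \<beta> m e * (c i * Y i m))
        + (if v = S then \<Sum>j<R. \<Sum>i\<in>N. \<alpha> j e * (c i * X i j) else 0)"
      by (simp only: sum.swap[of _ _ N])
    finally show ?thesis by (simp add: sum_distrib_left)
  qed
  moreover have "(\<Sum>i\<in>N. c i * Y i q) = (\<Sum>p | (p, q) \<in> edges G. \<Sum>i\<in>N. c i * Y i p)"
    if "v \<in> nodes G" "q \<in> inports G v" for v q
  proof -
    have "Y i q = (\<Sum>p | (p, q) \<in> edges G. Y i p)" if "i \<in> N" for i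
      using assms[OF that] \<open>v \<in> nodes G\<close> \<open>q \<in> inports G v\<close> unfolding transmission_def by blast
    then have "(\<Sum>i\<in>N. c i * Y i q) = (\<Sum>i\<in>N. \<Sum>p | (p, q) \<in> edges G. c i * Y i p)"
      by (intro sum.cong refl) (simp add: sum_distrib_left)
    also have "\<dots> = (\<Sum>p | (p, q) \<in> edges G. \<Sum>i\<in>N. c i * Y i p)" by (rule sum.swap)
    finally show ?thesis .
  qed
  ultimately show ?thesis unfolding transmission_def by simp
qed

section \<open>Cuts, decodability and descent to the base field\<close>

context coded_network
begin

lemma rank_cut_matrix:
  assumes "\<Omega> \<subseteq> nodes G"
  shows "R' \<le> (let C = cut_matrix G es \<Omega> :: 'f mat in vec_space.rank (dim_row C) C)
    \<longleftrightarrow> cut_ge TYPE('f::field) G R' \<Omega>"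
proof -
  let ?O = "\<Union>v\<in>\<Omega>. outports G v" and ?I = "\<Union>v\<in>nodes G - \<Omega>. inports G v"
  define rs where "rs = filter (\<lambda>e. e \<in> ?O) es"
  define cs where "cs = filter (\<lambda>e. e \<in> ?I) es"
  define C :: "'f mat" where "C = mat (length rs) (length cs) (\<lambda>(i, j). if (rs ! i, cs ! j) \<in> edges G then 1 else 0)"
  have C: "cut_matrix G es \<Omega> = C" by (simp add: cut_matrix_def C_def rs_def cs_def Let_def)
  have rs: "set rs = ?O" "distinct rs" using assms es by (auto simp: rs_def ports_def)
  have cs: "set cs = ?I" "distinct cs" using es by (auto simp: cs_def ports_def)
  have "rank_ge {..<length rs} {..<length cs} (\<lambda>i j. C $$ (i, j)) R' \<longleftrightarrow>
      rank_ge ?O ?I (edge_coeff G :: 'p \<Rightarrow> 'p \<Rightarrow> 'f) R'"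
    by (rule rank_ge_reindex[OF bij_betw_nth[OF rs(2) refl rs(1)[symmetric]] bij_betw_nth[OF cs(2) refl cs(1)[symmetric]]])
      (simp add: C_def edge_coeff_def)
  moreover have "C \<in> carrier_mat (length rs) (length cs)" by (simp add: C_def)
  ultimately show ?thesis using rank_ge_iff_rank[of C "length rs" "length cs" R']
    by (simp add: C cut_ge_def Let_def)
qed

lemma mincut_ge_iff:
  assumes "S \<noteq> T"
  shows "R' \<le> mincut TYPE('f::field) G es S T \<longleftrightarrow>
    (\<forall>\<Omega>. \<Omega> \<subseteq> nodes G \<longrightarrow> S \<in> \<Omega> \<longrightarrow> T \<notin> \<Omega> \<longrightarrow> cut_ge TYPE('f) G R' \<Omega>)"
proof -
  let ?cuts = "{\<Omega>. \<Omega> \<subseteq> nodes G \<and> S \<in> \<Omega> \<and> T \<notin> \<Omega>}"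
  have "finite ?cuts"
    by (rule finite_subset[of _ "Pow (nodes G)"]) (use network in \<open>auto simp: is_network_def\<close>)
  moreover have "{S} \<in> ?cuts" using S assms by auto
  ultimately have "R' \<le> mincut TYPE('f) G es S T \<longleftrightarrow>
    (\<forall>\<Omega>\<in>?cuts. R' \<le> (let C = cut_matrix G es \<Omega> :: 'f mat in vec_space.rank (dim_row C) C))"
    unfolding mincut_def by (subst Min_ge_iff) auto
  also have "\<dots> \<longleftrightarrow> (\<forall>\<Omega>\<in>?cuts. cut_ge TYPE('f) G R' \<Omega>)"
    by (rule ball_cong[OF refl]) (simp only: rank_cut_matrix mem_Collect_eq)
  finally show ?thesis by blast
qed

text \<open>If the cut form factors through \<open>r < R\<close> functionals, some nontrivial
  combination of the \<open>R\<close> unit inputs has a transmission \<open>Z\<close> that all of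
  them annihilate. Then nothing crosses the cut, and the destination sees only zeros.\<close>

lemma decodable_imp_cut_ge:
  fixes \<alpha> :: "nat \<Rightarrow> 'p \<Rightarrow> 'f::field"
  assumes dec: "decodable \<alpha> \<beta> \<epsilon>" and \<Omega>: "\<Omega> \<subseteq> nodes G" "S \<in> \<Omega>" "T \<notin> \<Omega>"
  shows "cut_ge TYPE('f) G R \<Omega>"
proof (rule ccontr)
  let ?O = "\<Union>v\<in>\<Omega>. outports G v" and ?I = "\<Union>v\<in>nodes G - \<Omega>. inports G v"
  let ?E = "edge_coeff G :: 'p \<Rightarrow> 'p \<Rightarrow> 'f"
  assume "\<not> cut_ge TYPE('f) G R \<Omega>"
  then have neg: "\<not> rank_ge ?O ?I ?E R" by (simp add: cut_ge_def)
  have fin: "finite ?O" "finite ?I"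
    using network \<Omega>(1) by (auto simp: is_network_def intro: finite_subset)
  obtain r U W where r: "r < R" and
    fac: "\<forall>u w. pairing ?O ?I ?E u w = (\<Sum>i<r. pairing ?O ?I ?E u (W i) * pairing ?O ?I ?E (U i) w)"
    using rank_le_factorization[OF neg] by (elim exE conjE)
  have "\<exists>Y. transmission G S R \<alpha> \<beta> (\<lambda>j. if j = i then 1 else 0) Y" for i
    by (rule transmission_exists)
  then obtain Y where Y: "\<And>i. transmission G S R \<alpha> \<beta> (\<lambda>j. if j = i then 1 else 0) (Y i)" by metis
  obtain c where c: "\<exists>j<R. c j \<noteq> 0" "\<And>k. k < r \<Longrightarrow> (\<Sum>j<R. pairing ?O ?I ?E (Y j) (W k) * c j) = 0"
    using homogeneous_system_nontrivial[OF r, of "\<lambda>k j. pairing ?O ?I ?E (Y j) (W k)"] by auto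
  define Z where "Z p = (\<Sum>i<R. c i * Y i p)" for p
  define X where "X j = (\<Sum>i<R. c i * (if j = i then 1 else 0))" for j
  have tr: "transmission G S R \<alpha> \<beta> X Z"
    unfolding X_def Z_def by (rule transmission_sum) (rule Y)
  have "pairing ?O ?I ?E Z (W k) = 0" if "k < r" for k
    using c(2)[OF that] unfolding Z_def pairing_left_linear by (simp add: mult.commute)
  then have "(\<Sum>i<r. pairing ?O ?I ?E Z (W i) * pairing ?O ?I ?E (U i) w) = 0" for w
    by (intro sum.neutral) simp
  then have Z0: "pairing ?O ?I ?E Z w = 0" for w using fac by metis
  have cut: "(\<Sum>p\<in>{p. (p, q) \<in> edges G} \<inter> (\<Union>w\<in>nodes G - (nodes G - \<Omega>). outports G w). Z p) = 0"
    if "v \<in> nodes G - \<Omega>" "q \<in> inports G v" for v q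
  proof -
    have q: "q \<in> ?I" using that by blast
    \<comment> \<open>Testing with the indicator of \<open>q\<close> isolates what arrives at
      \<open>q\<close> across the cut.\<close>
    have "(\<Sum>p\<in>?O. Z p * ?E p q) = (\<Sum>b\<in>?I. if b = q then \<Sum>p\<in>?O. Z p * ?E p q else 0)"
      using q fin(2) by simp
    also have "\<dots> = pairing ?O ?I ?E Z (\<lambda>b. if b = q then 1 else 0)"
      unfolding pairing_alt(1) by (rule sum.cong) auto
    finally have "(\<Sum>p\<in>?O. Z p * ?E p q) = 0" using Z0 by simp
    moreover have "(\<Sum>p\<in>?O. Z p * ?E p q) = (\<Sum>p\<in>{p. (p, q) \<in> edges G} \<inter> ?O. Z p)"
      using fin(1) by (intro sum.mono_neutral_cong_right) (auto simp: edge_coeff_def)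
    moreover have "nodes G - (nodes G - \<Omega>) = \<Omega>" using \<Omega>(1) by blast
    ultimately show ?thesis by simp
  qed
  have "Z p = 0" if "p \<in> inports G T" for p
  proof (rule downstream_zero[OF network acyclic tr, where D = "nodes G - \<Omega>" and v = T])
    show "\<forall>i<R. X i = 0" if "S \<in> nodes G - \<Omega>" using that \<Omega>(2) by blast
  qed (use \<Omega> T that cut in blast)+
  then have "decoded G T \<epsilon> Z k = 0" for k by (simp add: decoded_def)
  then have "\<forall>i<R. X i = 0" using dec tr unfolding decodable_def by blast
  moreover have "X j = c j" if "j < R" for j
  proof -
    have "X j = (\<Sum>i<R. if i = j then c i else 0)" unfolding X_def by (rule sum.cong) auto
    then show ?thesis using that by simp
  qed
  ultimately show False using c(1) by metis
qed

text \<open>Once \<open>S\<close> ignores its inputs and \<open>T\<close> stays silent, every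
  transmission is a \<open>flow\<close>, to which \<open>unicast_coding\<close> applies.\<close>

lemma cut_ge_imp_decodable_infinite:
  assumes inf: "infinite (UNIV :: 'k::field set)" and ST: "S \<noteq> T"
    and cuts: "\<And>\<Omega>. \<Omega> \<subseteq> nodes G \<Longrightarrow> S \<in> \<Omega> \<Longrightarrow> T \<notin> \<Omega> \<Longrightarrow> cut_ge TYPE('k) G R \<Omega>"
  shows "\<exists>(\<alpha> :: nat \<Rightarrow> 'p \<Rightarrow> 'k) \<beta> \<epsilon>. decodable \<alpha> \<beta> \<epsilon>"
proof -
  let ?E = "edge_coeff G :: 'p \<Rightarrow> 'p \<Rightarrow> 'k"
  \<comment> \<open>Cutting the port sets off outside \<open>nodes G\<close> makes finiteness and
    disjointness hold for all arguments, as \<open>unicast_coding\<close> demands.\<close>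
  define I where "I v = (if v \<in> nodes G then inports G v else {})" for v
  define J where "J v = (if v \<in> nodes G then outports G v else {})" for v
  define N where "N = nodes G - {S, T}"
  have IJ: "I v = inports G v" "J v = outports G v" if "v \<in> nodes G" for v
    using that by (simp_all add: I_def J_def)
  have "\<exists>\<alpha> \<beta> \<epsilon>. \<forall>X Y. flow I J S T N R ?E \<alpha> \<beta> X Y \<longrightarrow> (\<forall>k<R. (\<Sum>b\<in>I T. \<epsilon> b k * Y b) = X k)"
  \<comment> \<open>The arcs need not be transitive; their transitive closure is, and acyclicity
    makes it irreflexive.\<close>
  proof (rule unicast_coding[OF inf, where r = "(node_arcs G)\<^sup>+"])
    show "finite N" "finite (I v)" "finite (J v)" for v
      using network by (auto simp: N_def I_def J_def is_network_def)
    show "I v \<inter> I w = {}" if "v \<noteq> w" for v w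
      using inport_unique[OF network] that by (auto simp: I_def)
    show "J v \<inter> J w = {}" if "v \<noteq> w" for v w
      using outport_unique[OF network] that by (auto simp: J_def)
    show "S \<notin> N" "T \<notin> N" by (simp_all add: N_def)
    show "trans ((node_arcs G)\<^sup>+)" by (rule trans_trancl)
    show "irrefl ((node_arcs G)\<^sup>+)" using acyclic by (simp add: acyclic_network_def acyclic_irrefl)
    show "(v, w) \<in> (node_arcs G)\<^sup>+" if "v \<in> N" "w \<in> N" "a \<in> J v" "b \<in> I w" "?E a b \<noteq> 0" for v w a b
    proof (rule r_into_trancl)
      have "(a, b) \<in> edges G" using that(5) by (simp add: edge_coeff_def split: if_splits)
      moreover have "v \<in> nodes G" "w \<in> nodes G" using that by (simp_all add: N_def)
      ultimately show "(v, w) \<in> node_arcs G" using that(3,4) IJ by (auto simp: node_arcs_def)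
    qed
    show "rank_ge (\<Union>v\<in>insert S \<Omega>. J v) (\<Union>v\<in>insert T (N - \<Omega>). I v) ?E R" if "\<Omega> \<subseteq> N" for \<Omega>
    proof -
      have \<Omega>: "insert S \<Omega> \<subseteq> nodes G" "T \<notin> insert S \<Omega>" using that S ST by (auto simp: N_def)
      have "nodes G - insert S \<Omega> = insert T (N - \<Omega>)" using that T ST by (auto simp: N_def)
      moreover have "(\<Union>v\<in>nodes G - insert S \<Omega>. I v) = (\<Union>v\<in>nodes G - insert S \<Omega>. inports G v)"
        by (intro SUP_cong refl) (simp add: I_def)
      moreover have "(\<Union>v\<in>insert S \<Omega>. J v) = (\<Union>v\<in>insert S \<Omega>. outports G v)"
        by (intro SUP_cong refl) (use \<Omega> in \<open>auto simp: J_def\<close>)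
      ultimately show ?thesis using cuts[OF \<Omega>(1) _ \<Omega>(2)] by (simp only: cut_ge_def insert_iff simp_thms)
    qed
  qed
  then obtain \<alpha> \<beta> \<epsilon> where sol:
    "\<And>X Y. flow I J S T N R ?E \<alpha> \<beta> X Y \<Longrightarrow> \<forall>k<R. (\<Sum>b\<in>I T. \<epsilon> b k * Y b) = X k" by blast
  \<comment> \<open>Zero coefficients at the outputs of \<open>S\<close> and \<open>T\<close>
    realize the conventions built into \<open>flow\<close>.\<close>
  define \<beta>' where "\<beta>' m n = (if n \<in> outports G S \<union> outports G T then 0 else \<beta> m n)" for m n
  have "\<forall>i<R. X i = 0" if tr: "transmission G S R \<alpha> \<beta>' X Y" and dec: "\<forall>k<R. decoded G T \<epsilon> Y k = 0" for X Y
  proof -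
    have YT: "Y e = 0" if "e \<in> outports G T" for e
    proof -
      have "Y e = (\<Sum>m\<in>inports G T. \<beta>' m e * Y m) + (if T = S then \<Sum>i<R. \<alpha> i e * X i else 0)"
        using tr T that unfolding transmission_def by blast
      then show ?thesis using that ST by (simp add: \<beta>'_def)
    qed
    have "flow I J S T N R ?E \<alpha> \<beta> X Y" unfolding flow_def
    proof (intro conjI ballI)
      fix e assume e: "e \<in> J S"
      then have e: "e \<in> outports G S" using IJ S by simp
      have "Y e = (\<Sum>m\<in>inports G S. \<beta>' m e * Y m) + (if S = S then \<Sum>i<R. \<alpha> i e * X i else 0)"
        using tr S e unfolding transmission_def by blast
      then show "Y e = (\<Sum>i<R. \<alpha> i e * X i)" using e by (simp add: \<beta>'_def)
    next
      fix v e assume v: "v \<in> N" and e: "e \<in> J v"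
      have v': "v \<in> nodes G" "v \<noteq> S" "v \<noteq> T" using v by (auto simp: N_def)
      have e': "e \<in> outports G v" using e IJ v' by simp
      have "e \<notin> outports G S" "e \<notin> outports G T"
        using outport_unique[OF network v'(1) S e'] outport_unique[OF network v'(1) T e'] v' by auto
      then have "\<beta>' m e = \<beta> m e" for m by (simp add: \<beta>'_def)
      moreover have "Y e = (\<Sum>m\<in>inports G v. \<beta>' m e * Y m) + (if v = S then \<Sum>i<R. \<alpha> i e * X i else 0)"
        using tr v' e' unfolding transmission_def by blast
      ultimately show "Y e = (\<Sum>m\<in>I v. \<beta> m e * Y m)" using v' IJ by simp
    next
      fix v b assume v: "v \<in> insert T N" and b: "b \<in> I v"
      have v': "v \<in> nodes G" using v T by (auto simp: N_def)
      have "Y b = (\<Sum>p | (p, b) \<in> edges G. Y p)"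
        using tr v' b IJ unfolding transmission_def by blast
      also have "\<dots> = (\<Sum>p\<in>{p. (p, b) \<in> edges G} \<inter> (\<Union>w\<in>insert S N. J w). Y p)"
      proof (rule sum.mono_neutral_right)
        show "finite {p. (p, b) \<in> edges G}" by (rule edge_sources[OF network])
        show "\<forall>p\<in>{p. (p, b) \<in> edges G} - {p. (p, b) \<in> edges G} \<inter> (\<Union>w\<in>insert S N. J w). Y p = 0"
        proof
          fix p assume p: "p \<in> {p. (p, b) \<in> edges G} - {p. (p, b) \<in> edges G} \<inter> (\<Union>w\<in>insert S N. J w)"
          then have "(p, b) \<in> edges G" by blast
          from edge_ports[OF network this] obtain w where w: "w \<in> nodes G" "p \<in> outports G w" by metis
          have "w \<notin> insert S N" using p w IJ(2)[OF w(1)] by blast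
          then have "w = T" using w(1) by (auto simp: N_def)
          then show "Y p = 0" using YT w(2) by blast
        qed
      qed blast
      also have "\<dots> = (\<Sum>a\<in>(\<Union>w\<in>insert S N. J w). Y a * ?E a b)"
      proof (rule sum.mono_neutral_cong_left)
        show "finite (\<Union>w\<in>insert S N. J w)" using network by (auto simp: N_def J_def is_network_def)
      qed (auto simp: edge_coeff_def)
      finally show "Y b = (\<Sum>a\<in>(\<Union>w\<in>insert S N. J w). Y a * ?E a b)" .
    qed
    from sol[OF this] show ?thesis using dec T IJ by (simp add: decoded_def)
  qed
  then have "decodable \<alpha> \<beta>' \<epsilon>" unfolding decodable_def by blast
  then show ?thesis by blast
qed

text \<open>Rows \<open>Inl k\<close> are decoder outputs and rows \<open>Inr q\<close> port
  equations; columns are source symbols and port symbols. Since the port symbols remain unknowns,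
  each coefficient sits in one entry, whereas \<open>system_matrix\<close> contains products of
  coefficients.\<close>

definition lin_system ::
  "(nat \<Rightarrow> 'p \<Rightarrow> 'f) \<Rightarrow> ('p \<Rightarrow> 'p \<Rightarrow> 'f) \<Rightarrow> ('p \<Rightarrow> nat \<Rightarrow> 'f::field) \<Rightarrow> nat + 'p \<Rightarrow> nat + 'p \<Rightarrow> 'f" where
  "lin_system \<alpha> \<beta> \<epsilon> r c = (case r of
     Inl k \<Rightarrow> (case c of Inl i \<Rightarrow> 0 | Inr p \<Rightarrow> if p \<in> inports G T then \<epsilon> p k else 0)
   | Inr q \<Rightarrow> (case c of Inl i \<Rightarrow> if q \<in> outports G S then \<alpha> i q else 0
                       | Inr p \<Rightarrow> port_coeff G \<beta> p q - (if p = q then 1 else 0)))"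

lemma lin_system_zero_iff:
  fixes \<alpha> :: "nat \<Rightarrow> 'p \<Rightarrow> 'f::field"
  shows "(\<forall>r\<in>{..<R} <+> ports G. (\<Sum>c\<in>{..<R} <+> ports G. lin_system \<alpha> \<beta> \<epsilon> r c * y c) = 0) \<longleftrightarrow>
   transmission G S R \<alpha> \<beta> (\<lambda>i. y (Inl i)) (\<lambda>p. y (Inr p)) \<and>
   (\<forall>k<R. decoded G T \<epsilon> (\<lambda>p. y (Inr p)) k = 0)"
proof -
  have fin: "finite (ports G)" by (rule finite_ports[OF network])
  have row: "(\<Sum>c\<in>{..<R} <+> ports G. lin_system \<alpha> \<beta> \<epsilon> r c * y c) =
    (\<Sum>i<R. lin_system \<alpha> \<beta> \<epsilon> r (Inl i) * y (Inl i)) + (\<Sum>p\<in>ports G. lin_system \<alpha> \<beta> \<epsilon> r (Inr p) * y (Inr p))" for r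
    using fin by (simp add: sum.Plus comp_def)
  have dec: "(\<Sum>c\<in>{..<R} <+> ports G. lin_system \<alpha> \<beta> \<epsilon> (Inl k) c * y c) = decoded G T \<epsilon> (\<lambda>p. y (Inr p)) k" for k
  proof -
    have "(\<Sum>p\<in>ports G. (if p \<in> inports G T then \<epsilon> p k else 0) * y (Inr p)) = (\<Sum>p\<in>inports G T. \<epsilon> p k * y (Inr p))"
    proof (rule sum.mono_neutral_cong_right[OF fin])
      show "inports G T \<subseteq> ports G" using T by (auto simp: ports_def)
    qed auto
    then show ?thesis unfolding row by (simp add: lin_system_def decoded_def)
  qed
  have tr: "(\<Sum>c\<in>{..<R} <+> ports G. lin_system \<alpha> \<beta> \<epsilon> (Inr q) c * y c) = 0 \<longleftrightarrow> y (Inr q) =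
    (\<Sum>p\<in>ports G. port_coeff G \<beta> p q * y (Inr p)) + (if q \<in> outports G S then \<Sum>i<R. \<alpha> i q * y (Inl i) else 0)"
    if q: "q \<in> ports G" for q
  proof -
    have "(\<Sum>p\<in>ports G. (port_coeff G \<beta> p q - (if p = q then 1 else 0)) * y (Inr p))
      = (\<Sum>p\<in>ports G. port_coeff G \<beta> p q * y (Inr p) - (if p = q then y (Inr p) else 0))"
      by (intro sum.cong) (auto simp: algebra_simps)
    also have "\<dots> = (\<Sum>p\<in>ports G. port_coeff G \<beta> p q * y (Inr p)) - y (Inr q)"
      using q fin by (simp add: sum_subtractf)
    finally have eq: "(\<Sum>c\<in>{..<R} <+> ports G. lin_system \<alpha> \<beta> \<epsilon> (Inr q) c * y c) =
      (if q \<in> outports G S then \<Sum>i<R. \<alpha> i q * y (Inl i) else 0) +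
      ((\<Sum>p\<in>ports G. port_coeff G \<beta> p q * y (Inr p)) - y (Inr q))"
      unfolding row by (simp add: lin_system_def)
    have "a + (b - z) = 0 \<longleftrightarrow> z = b + a" for a b z :: 'f by (auto simp: algebra_simps)
    then show ?thesis unfolding eq by blast
  qed
  have plus: "(\<forall>r\<in>{..<R} <+> ports G. Q r) \<longleftrightarrow> (\<forall>k<R. Q (Inl k)) \<and> (\<forall>q\<in>ports G. Q (Inr q))" for Q
    by auto
  have "(\<forall>q\<in>ports G. (\<Sum>c\<in>{..<R} <+> ports G. lin_system \<alpha> \<beta> \<epsilon> (Inr q) c * y c) = 0) \<longleftrightarrow>
      transmission G S R \<alpha> \<beta> (\<lambda>i. y (Inl i)) (\<lambda>p. y (Inr p))"
    unfolding transmission_iff[OF network S] by (rule ball_cong[OF refl]) (rule tr)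
  then show ?thesis unfolding plus dec by (simp only: conj_commute)
qed

text \<open>Decodability is injectivity of \<open>lin_system\<close>. After the coefficients have
  become 0 or 1, all entries lie in the image of \<open>h\<close>, so the system comes from one over
  the small field, and \<open>h\<close> reflects zero.\<close>

lemma decodable_descend:
  fixes h :: "'f::field \<Rightarrow> 'k::field"
  assumes h: "h 0 = 0" "h 1 = 1" "\<And>x y. h (x + y) = h x + h y" "\<And>x y. h (x * y) = h x * h y"
    "\<And>x y. h (x - y) = h x - h y" "\<And>x. h x = 0 \<Longrightarrow> x = 0"
    and dec: "decodable (\<alpha> :: nat \<Rightarrow> 'p \<Rightarrow> 'k) \<beta> \<epsilon>"
  shows "\<exists>(\<alpha> :: nat \<Rightarrow> 'p \<Rightarrow> 'f) \<beta> \<epsilon>. decodable \<alpha> \<beta> \<epsilon>"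
proof -
  let ?C = "{..<R} <+> ports G"
  \<comment> \<open>The positions of the free coefficients; all other entries are 0, 1 or
    -1.\<close>
  define P where "P = {(r, c). r \<in> ?C \<and> c \<in> ?C \<and> (case r of
      Inl k \<Rightarrow> (case c of Inl i \<Rightarrow> False | Inr p \<Rightarrow> p \<in> inports G T)
    | Inr q \<Rightarrow> (case c of Inl i \<Rightarrow> q \<in> outports G S
                        | Inr p \<Rightarrow> \<exists>v\<in>nodes G. p \<in> inports G v \<and> q \<in> outports G v))}"
  have fin: "finite ?C" using finite_ports[OF network] by simp
  have P: "P \<subseteq> ?C \<times> ?C" by (auto simp: P_def)
  have "finite P" using P fin by (meson finite_SigmaI finite_subset)
  have inj: "\<forall>y. (\<forall>r\<in>?C. (\<Sum>c\<in>?C. lin_system \<alpha> \<beta> \<epsilon> r c * y c) = 0) \<longrightarrow> (\<forall>c\<in>?C. y c = 0)"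
  proof (intro allI impI)
    fix y assume ker: "\<forall>r\<in>?C. (\<Sum>c\<in>?C. lin_system \<alpha> \<beta> \<epsilon> r c * y c) = 0"
    have tr: "transmission G S R \<alpha> \<beta> (\<lambda>i. y (Inl i)) (\<lambda>p. y (Inr p))"
      and d: "\<forall>k<R. decoded G T \<epsilon> (\<lambda>p. y (Inr p)) k = 0"
      using lin_system_zero_iff[of \<alpha> \<beta> \<epsilon> y] ker by blast+
    have X: "\<forall>i<R. y (Inl i) = 0" using dec tr d unfolding decodable_def by blast
    then have "\<forall>p\<in>ports G. y (Inr p) = 0" using transmission_zero[OF network acyclic tr] by blast
    then show "\<forall>c\<in>?C. y c = 0" using X by (auto simp: Plus_def)
  qed
  from injective_system_01[OF fin \<open>finite P\<close> P inj] obtain L where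
    L1: "\<forall>r c. (r, c) \<notin> P \<longrightarrow> L r c = lin_system \<alpha> \<beta> \<epsilon> r c" and
    L2: "\<forall>r c. (r, c) \<in> P \<longrightarrow> L r c \<in> {0, 1}" and
    L3: "\<forall>y. (\<forall>r\<in>?C. (\<Sum>c\<in>?C. L r c * y c) = 0) \<longrightarrow> (\<forall>c\<in>?C. y c = 0)"
    by (elim exE conjE)
  define g where "g r c = (if L r c = 0 then 0 else 1 :: 'f)" for r c
  have g: "h (g r c) = L r c" if "(r, c) \<in> P" for r c
    using L2 that h(1,2) by (auto simp: g_def)
  define \<alpha>' where "\<alpha>' i q = g (Inr q) (Inl i)" for i q
  define \<beta>' where "\<beta>' p q = g (Inr q) (Inr p)" for p q
  define \<epsilon>' where "\<epsilon>' p k = g (Inl k) (Inr p)" for p k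
  have L: "L r c = h (lin_system \<alpha>' \<beta>' \<epsilon>' r c)" if r: "r \<in> ?C" and c: "c \<in> ?C" for r c
  proof (cases "(r, c) \<in> P")
    case True
    have "lin_system \<alpha>' \<beta>' \<epsilon>' r c = g r c"
    proof (cases r; cases c)
      fix q p assume rc: "r = Inr q" "c = Inr p"
      then obtain v where v: "v \<in> nodes G" "p \<in> inports G v" "q \<in> outports G v"
        using True by (auto simp: P_def)
      \<comment> \<open>A local coefficient sits off the diagonal and at a pair that is no edge, so
        neither the identity nor an edge entry interferes with it.\<close>
      have "p \<noteq> q" using inport_outport_disjoint[OF network v(1) v(1) v(2)] v(3) by blast
      moreover have "(p, q) \<notin> edges G"
        using edge_ports[OF network] inport_outport_disjoint[OF network _ v(1)] v(3) by metis
      ultimately show ?thesis using v rc by (auto simp: lin_system_def port_coeff_def \<beta>'_def)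
    qed (use True in \<open>auto simp: P_def lin_system_def \<alpha>'_def \<epsilon>'_def\<close>)
    then show ?thesis using g[OF True] by simp
  next
    case False
    then have "lin_system \<alpha> \<beta> \<epsilon> r c = h (lin_system \<alpha>' \<beta>' \<epsilon>' r c)"
      using r c h(1,2,5) by (auto simp: P_def lin_system_def port_coeff_def split: sum.split)
    then show ?thesis using L1 False by simp
  qed
  have hsum: "h (sum f A) = (\<Sum>x\<in>A. h (f x))" for f :: "'z \<Rightarrow> 'f" and A
    using h(1,3) by (induction A rule: infinite_finite_induct) simp_all
  have "\<forall>i<R. X i = 0" if "transmission G S R \<alpha>' \<beta>' X Y" "\<forall>k<R. decoded G T \<epsilon>' Y k = 0" for X Y
  proof -
    define y where "y = case_sum X Y"
    have y: "X = (\<lambda>i. y (Inl i))" "Y = (\<lambda>p. y (Inr p))" by (simp_all add: y_def)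
    have "(\<Sum>c\<in>?C. lin_system \<alpha>' \<beta>' \<epsilon>' r c * y c) = 0" if "r \<in> ?C" for r
      using lin_system_zero_iff[of \<alpha>' \<beta>' \<epsilon>' y] \<open>transmission G S R \<alpha>' \<beta>' X Y\<close> \<open>\<forall>k<R. decoded G T \<epsilon>' Y k = 0\<close> that
      unfolding y by blast
    then have "h (\<Sum>c\<in>?C. lin_system \<alpha>' \<beta>' \<epsilon>' r c * y c) = 0" if "r \<in> ?C" for r
      using that h(1) by simp
    \<comment> \<open>Entrywise, \<open>h\<close> carries a kernel vector over the small field to a
      kernel vector of \<open>L\<close>.\<close>
    then have "\<forall>r\<in>?C. (\<Sum>c\<in>?C. L r c * h (y c)) = 0"
      by (simp add: hsum h(4) L cong: sum.cong)
    from L3[THEN spec, THEN mp, OF this] have "\<forall>c\<in>?C. h (y c) = 0" .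
    moreover have "Inl i \<in> ?C" if "i < R" for i using that by (intro InlI) simp
    ultimately have "h (X i) = 0" if "i < R" for i using that unfolding y(1) by blast
    then show ?thesis using h(6) by blast
  qed
  then have "decodable \<alpha>' \<beta>' \<epsilon>'" unfolding decodable_def by blast
  then show ?thesis by blast
qed

lemma cut_ge_imp_decodable:
  assumes ST: "S \<noteq> T"
    and cuts: "\<And>\<Omega>. \<Omega> \<subseteq> nodes G \<Longrightarrow> S \<in> \<Omega> \<Longrightarrow> T \<notin> \<Omega> \<Longrightarrow> cut_ge TYPE('f::field) G R \<Omega>"
  shows "\<exists>(\<alpha> :: nat \<Rightarrow> 'p \<Rightarrow> 'f) \<beta> \<epsilon>. decodable \<alpha> \<beta> \<epsilon>"
proof -
  define h :: "'f \<Rightarrow> 'f poly fract" where "h c = to_fract [:c:]" for c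
  have h01: "h 0 = 0" "h 1 = 1" "h x = 0 \<Longrightarrow> x = 0" for x
    by (simp_all add: h_def flip: one_pCons)
  have hadd: "h (x + y) = h x + h y" for x y by (simp add: h_def flip: to_fract_add)
  have hmult: "h (x * y) = h x * h y" for x y by (simp add: h_def flip: to_fract_mult)
  have hdiff: "h (x - y) = h x - h y" for x y by (simp add: h_def flip: to_fract_diff)
  \<comment> \<open>The powers of the indeterminate are distinct, so the field of rational functions
    is infinite.\<close>
  have "inj (\<lambda>n. to_fract (monom (1 :: 'f) n))" by (intro injI) (simp add: monom_eq_iff')
  then have "infinite (range (\<lambda>n. to_fract (monom (1 :: 'f) n)))" by (rule range_inj_infinite)
  then have inf: "infinite (UNIV :: 'f poly fract set)" by (rule infinite_super[OF subset_UNIV])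
  have "cut_ge TYPE('f poly fract) G R \<Omega>" if "\<Omega> \<subseteq> nodes G" "S \<in> \<Omega>" "T \<notin> \<Omega>" for \<Omega>
  proof -
    have E: "(\<lambda>p q. h (edge_coeff G p q)) = edge_coeff G" by (intro ext) (simp add: edge_coeff_def h01)
    show ?thesis
      using rank_ge_hom[of h, OF h01(1,2) hadd hmult cuts[OF that, unfolded cut_ge_def]] unfolding cut_ge_def E .
  qed
  from cut_ge_imp_decodable_infinite[OF inf ST this] obtain \<alpha> :: "nat \<Rightarrow> 'p \<Rightarrow> 'f poly fract" and \<beta> \<epsilon>
    where "decodable \<alpha> \<beta> \<epsilon>" by blast
  then show ?thesis by (rule decodable_descend[of h, rotated 6]) (fact h01 hadd hmult hdiff)+
qed

end

theorem theorem3: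
  fixes G :: "('v, 'p) network"
    and es :: "'p list"
    and S T :: 'v
    and R :: nat
  assumes "is_network G"
    and "acyclic_network G"
    and "distinct es" and "set es = ports G"
    and "S \<in> nodes G" and "T \<in> nodes G" and "S \<noteq> T"
    and "R \<le> card (outports G S)"
  shows "(feasible TYPE('f::{finite,field}) G S T R \<longleftrightarrow> mincut TYPE('f) G es S T \<ge> R) \<and>
    (mincut TYPE('f) G es S T \<ge> R \<longleftrightarrow>
      (\<exists>(\<alpha> :: nat \<Rightarrow> 'p \<Rightarrow> 'f) \<beta> \<epsilon>. invertible_mat (system_matrix G es S T R \<alpha> \<beta> \<epsilon>)))"
proof -
  interpret coded_network G es S T R using assms by unfold_locales
  have "mincut TYPE('f) G es S T \<ge> R \<longleftrightarrow> (\<exists>(\<alpha> :: nat \<Rightarrow> 'p \<Rightarrow> 'f) \<beta> \<epsilon>. decodable \<alpha> \<beta> \<epsilon>)"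
    unfolding mincut_ge_iff[OF \<open>S \<noteq> T\<close>]
    using cut_ge_imp_decodable[OF \<open>S \<noteq> T\<close>, where 'f = 'f] decodable_imp_cut_ge[where 'f = 'f] by blast
  then show ?thesis using feasible_iff_invertible[where 'f = 'f] invertible_iff_decodable[where 'f = 'f] by simp
qed

end
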